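(* Let $n\in\mathbb N$, let $W_1,\dots,W_n\in\mathcal O_{\widetilde{\mathcal W}}$ be simple nontrivial $\widetilde{\mathcal W}$-modules, let $V\in\mathcal O_{\mathcal L}$ be a simple $\mathcal L$-module, and let $\lambda_1,\dots,\lambda_n\in\mathbb C^*$ be pairwise distinct. Then the $\mathcal L$-module $V\otimes W_1[\lambda_1]\otimes W_2[\lambda_2]\otimes\cdots\otimes W_n[\lambda_n]$ is simple.
   Context: $\mathcal{L}$ has basis $\{d_n=t^{n+1}\frac{d}{dt},I_n=t^n,z_1,z_2,z_3\mid n\in\mathbb{Z}\}$ with brackets $[d_n,d_m]=(m-n)d_{m+n}+\delta_{n,-m}\frac{n^3-n}{12}z_1$, $[d_n,I_m]=mI_{m+n}+\delta_{n,-m}(n^2+n)z_2$, $[I_n,I_m]=n\delta_{n,-m}z_3$, $z_i$ central, graded by $\deg d_i=\deg I_i=i$, $\deg z_j=0$. $\widetilde{\mathcal W}=\mathbb C[t]\frac{d}{dt}+\mathbb C[t]$ (spanned by $d_i$, $i\ge-1$, $I_i$, $i\ge0$). For $L=\mathcal L$ or $\widetilde{\mathcal W}$, $\mathcal O_L$ is the category of $L$-modules in which every vector is annihilated by all homogeneous elements of sufficiently large degree. A module in $\mathcal O_{\widetilde{\mathcal W}}$ is naturally a module over $\mathbb C[[t]]\frac{d}{dt}+\mathbb C[[t]]$. For $\lambda\in\mathbb C^*$ and $W\in\mathcal O_{\widetilde{\mathcal W}}$, $W[\lambda]$ is the $\mathcal L$-module on the space $W$ with $z_i\circ w=0$, $(f(t)\frac{d}{dt})\circ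 w=(f(t+\lambda)\frac{d}{dt})w$, $f(t)\circ w=f(t+\lambda)w$ for $f\in\mathbb C[t,t^{-1}]$, where $(t+\lambda)^m=\sum_{i\ge0}\binom{m}{i}\lambda^{m-i}t^i\in\mathbb C[[t]]$. *)

theory Defs
  imports Complex_Main "HOL-Library.FuncSet"
begin

text \<open>Vector spaces are represented by a chosen basis: a complex vector space with
basis B is the space of finitely supported functions B -> complex.
Tensor products of spaces with bases B_0,...,B_n then have basis B_0 x ... x B_n.\<close>

type_synonym 'b vec = "'b \<Rightarrow> complex"

definition fsupp :: "'b set \<Rightarrow> 'b vec set" where
  "fsupp B = {f. finite {b. f b \<noteq> 0} \<and> {b. f b \<noteq> 0} \<subseteq> B}"

definition delta :: "'b \<Rightarrow> 'b vec" where
  "delta b = (\<lambda>c. if c = b then 1 else 0)"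

definition endo_on :: "'b vec set \<Rightarrow> ('b vec \<Rightarrow> 'b vec) \<Rightarrow> bool" where
  "endo_on S \<phi> \<longleftrightarrow> (\<forall>f\<in>S. \<phi> f \<in> S)
     \<and> (\<forall>f\<in>S. \<forall>g\<in>S. \<phi> (\<lambda>b. f b + g b) = (\<lambda>b. \<phi> f b + \<phi> g b))
     \<and> (\<forall>c. \<forall>f\<in>S. \<phi> (\<lambda>b. c * f b) = (\<lambda>b. c * \<phi> f b))"

definition comm :: "('b vec \<Rightarrow> 'b vec) \<Rightarrow> ('b vec \<Rightarrow> 'b vec) \<Rightarrow> 'b vec \<Rightarrow> 'b vec" where
  "comm A B v = (\<lambda>b. A (B v) b - B (A v) b)"

definition L_module :: "'b set \<Rightarrow> (int \<Rightarrow> 'b vec \<Rightarrow> 'b vec) \<Rightarrow> (int \<Rightarrow> 'b vec \<Rightarrow> 'b vec)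
    \<Rightarrow> (nat \<Rightarrow> 'b vec \<Rightarrow> 'b vec) \<Rightarrow> bool" where
  "L_module B rd rI rz \<longleftrightarrow>
     (\<forall>m. endo_on (fsupp B) (rd m) \<and> endo_on (fsupp B) (rI m))
   \<and> (\<forall>k\<in>{1,2,3}. endo_on (fsupp B) (rz k))
   \<and> (\<forall>v\<in>fsupp B. \<forall>n m.
        comm (rd n) (rd m) v = (\<lambda>b. of_int (m - n) * rd (m + n) v b
            + (if n = - m then of_int (n^3 - n) / 12 * rz 1 v b else 0))
      \<and> comm (rd n) (rI m) v = (\<lambda>b. of_int m * rI (m + n) v b
            + (if n = - m then of_int (n^2 + n) * rz 2 v b else 0))
      \<and> comm (rI n) (rI m) v = (\<lambda>b. if n = - m then of_int n * rz 3 v b else 0))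
   \<and> (\<forall>v\<in>fsupp B. \<forall>k\<in>{1,2,3}. \<forall>n.
        comm (rz k) (rd n) v = (\<lambda>_. 0) \<and> comm (rz k) (rI n) v = (\<lambda>_. 0)
      \<and> (\<forall>k'\<in>{1,2,3}. comm (rz k) (rz k') v = (\<lambda>_. 0)))"

definition L_submodule :: "'b set \<Rightarrow> (int \<Rightarrow> 'b vec \<Rightarrow> 'b vec) \<Rightarrow> (int \<Rightarrow> 'b vec \<Rightarrow> 'b vec)
    \<Rightarrow> (nat \<Rightarrow> 'b vec \<Rightarrow> 'b vec) \<Rightarrow> 'b vec set \<Rightarrow> bool" where
  "L_submodule B rd rI rz U \<longleftrightarrow> U \<subseteq> fsupp B \<and> (\<lambda>_. 0) \<in> U
     \<and> (\<forall>f\<in>U. \<forall>g\<in>U. (\<lambda>b. f b + g b) \<in> U) \<and> (\<forall>c. \<forall>f\<in>U. (\<lambda>b. c * f b) \<in> U)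
     \<and> (\<forall>u\<in>U. (\<forall>m. rd m u \<in> U \<and> rI m u \<in> U) \<and> (\<forall>k\<in>{1,2,3}. rz k u \<in> U))"

definition simple_L :: "'b set \<Rightarrow> (int \<Rightarrow> 'b vec \<Rightarrow> 'b vec) \<Rightarrow> (int \<Rightarrow> 'b vec \<Rightarrow> 'b vec)
    \<Rightarrow> (nat \<Rightarrow> 'b vec \<Rightarrow> 'b vec) \<Rightarrow> bool" where
  "simple_L B rd rI rz \<longleftrightarrow> L_module B rd rI rz \<and> B \<noteq> {}
     \<and> (\<forall>U. L_submodule B rd rI rz U \<longrightarrow> U = {\<lambda>_. 0} \<or> U = fsupp B)"

definition in_O_L :: "'b set \<Rightarrow> (int \<Rightarrow> 'b vec \<Rightarrow> 'b vec) \<Rightarrow> (int \<Rightarrow> 'b vec \<Rightarrow> 'b vec) \<Rightarrow> bool" where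
  "in_O_L B rd rI \<longleftrightarrow> (\<forall>v\<in>fsupp B. \<exists>N::int. \<forall>k>N. rd k v = (\<lambda>_. 0) \<and> rI k v = (\<lambda>_. 0))"

text \<open>A module over W~ = C[t]d/dt + C[t]: d_n (n >= -1) acts by rd n, I_n (n >= 0) by rI n;
  other values of rd, rI are irrelevant.\<close>
definition W_module :: "'b set \<Rightarrow> (int \<Rightarrow> 'b vec \<Rightarrow> 'b vec) \<Rightarrow> (int \<Rightarrow> 'b vec \<Rightarrow> 'b vec) \<Rightarrow> bool" where
  "W_module B rd rI \<longleftrightarrow>
     (\<forall>m\<ge>-1. endo_on (fsupp B) (rd m)) \<and> (\<forall>m\<ge>0. endo_on (fsupp B) (rI m))
   \<and> (\<forall>v\<in>fsupp B. \<forall>n m.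
        (n \<ge> -1 \<and> m \<ge> -1 \<longrightarrow> comm (rd n) (rd m) v = (\<lambda>b. of_int (m - n) * rd (m + n) v b))
      \<and> (n \<ge> -1 \<and> m \<ge> 0 \<longrightarrow> comm (rd n) (rI m) v = (\<lambda>b. of_int m * rI (m + n) v b))
      \<and> (n \<ge> 0 \<and> m \<ge> 0 \<longrightarrow> comm (rI n) (rI m) v = (\<lambda>_. 0)))"

definition W_submodule :: "'b set \<Rightarrow> (int \<Rightarrow> 'b vec \<Rightarrow> 'b vec) \<Rightarrow> (int \<Rightarrow> 'b vec \<Rightarrow> 'b vec)
    \<Rightarrow> 'b vec set \<Rightarrow> bool" where
  "W_submodule B rd rI U \<longleftrightarrow> U \<subseteq> fsupp B \<and> (\<lambda>_. 0) \<in> U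
     \<and> (\<forall>f\<in>U. \<forall>g\<in>U. (\<lambda>b. f b + g b) \<in> U) \<and> (\<forall>c. \<forall>f\<in>U. (\<lambda>b. c * f b) \<in> U)
     \<and> (\<forall>u\<in>U. (\<forall>m\<ge>-1. rd m u \<in> U) \<and> (\<forall>m\<ge>0. rI m u \<in> U))"

definition simple_W :: "'b set \<Rightarrow> (int \<Rightarrow> 'b vec \<Rightarrow> 'b vec) \<Rightarrow> (int \<Rightarrow> 'b vec \<Rightarrow> 'b vec) \<Rightarrow> bool" where
  "simple_W B rd rI \<longleftrightarrow> W_module B rd rI \<and> B \<noteq> {}
     \<and> (\<forall>U. W_submodule B rd rI U \<longrightarrow> U = {\<lambda>_. 0} \<or> U = fsupp B)"

definition nontrivial_W :: "'b set \<Rightarrow> (int \<Rightarrow> 'b vec \<Rightarrow> 'b vec) \<Rightarrow> (int \<Rightarrow> 'b vec \<Rightarrow> 'b vec) \<Rightarrow> bool" where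
  "nontrivial_W B rd rI \<longleftrightarrow>
     (\<exists>v\<in>fsupp B. (\<exists>m\<ge>-1. rd m v \<noteq> (\<lambda>_. 0)) \<or> (\<exists>m\<ge>0. rI m v \<noteq> (\<lambda>_. 0)))"

definition in_O_W :: "'b set \<Rightarrow> (int \<Rightarrow> 'b vec \<Rightarrow> 'b vec) \<Rightarrow> (int \<Rightarrow> 'b vec \<Rightarrow> 'b vec) \<Rightarrow> bool" where
  "in_O_W B rd rI \<longleftrightarrow> (\<forall>v\<in>fsupp B. \<exists>N::int. \<forall>k>N. rd k v = (\<lambda>_. 0) \<and> rI k v = (\<lambda>_. 0))"

text \<open>The W[lambda] action: t^(m+1) d/dt acts as (t+lam)^(m+1) d/dt
  = sum_i binom(m+1,i) lam^(m+1-i) d_(i-1); t^m acts as sum_i binom(m,i) lam^(m-i) I_i.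
  The sums are finite for modules in O (only finitely many nonzero terms).\<close>
definition shift_d :: "complex \<Rightarrow> (int \<Rightarrow> 'b vec \<Rightarrow> 'b vec) \<Rightarrow> int \<Rightarrow> 'b vec \<Rightarrow> 'b vec" where
  "shift_d lam rd m w = (\<lambda>b. \<Sum>i\<in>{i::nat. rd (int i - 1) w \<noteq> (\<lambda>_. 0)}.
      ((of_int (m + 1) :: complex) gchoose i) * lam powi (m + 1 - int i) * rd (int i - 1) w b)"

definition shift_I :: "complex \<Rightarrow> (int \<Rightarrow> 'b vec \<Rightarrow> 'b vec) \<Rightarrow> int \<Rightarrow> 'b vec \<Rightarrow> 'b vec" where
  "shift_I lam rI m w = (\<lambda>b. \<Sum>i\<in>{i::nat. rI (int i) w \<noteq> (\<lambda>_. 0)}.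
      ((of_int m :: complex) gchoose i) * lam powi (m - int i) * rI (int i) w b)"

text \<open>Action of one Lie algebra element x on V (x) W_1 (x) ... (x) W_n, realised on
  finitely supported functions of basis tuples (a, g) with g in PiE {1..n} Bs:
  x(v (x) w_1 (x) ... ) = (x v) (x) w_1 ... + sum_j v (x) ... (x) (x w_j) (x) ...
  Here A is the action of x on V and Bop j its action on the j-th factor.\<close>
definition tens_op :: "('a vec \<Rightarrow> 'a vec) \<Rightarrow> (nat \<Rightarrow> 'b vec \<Rightarrow> 'b vec) \<Rightarrow> nat
    \<Rightarrow> ('a \<times> (nat \<Rightarrow> 'b)) vec \<Rightarrow> ('a \<times> (nat \<Rightarrow> 'b)) vec" where
  "tens_op A Bop n F = (\<lambda>(a, g). \<Sum>p\<in>{p. F p \<noteq> 0}. F p *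
      ((if snd p = g then A (delta (fst p)) a else 0)
       + (\<Sum>j\<in>{1..n}. if fst p = a \<and> (\<forall>i. i \<noteq> j \<longrightarrow> snd p i = g i)
                       then Bop j (delta (snd p j)) (g j) else 0)))"

end

theory Submission
  imports Defs "HOL-Library.Function_Algebras" "HOL-Analysis.Continuum_Not_Denumerable"
    "HOL-Computational_Algebra.Fundamental_Theorem_Algebra"
    "HOL-Computational_Algebra.Polynomial_Factorial"
    "HOL-Computational_Algebra.Field_as_Ring"
    "HOL-Computational_Algebra.Formal_Power_Series"
begin

text \<open>On a fixed vector \<open>u\<close> of a submodule, \<open>f(t) d/dt\<close> with \<open>f\<close> divisible by a high power of \<open>t\<close> kills
  the factor \<open>V\<close> and acts on the \<open>j\<close>-th factor through a finite Taylor jet of \<open>f\<close> at \<open>\<lambda>\<^sub>j\<close>.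
  The \<open>\<lambda>\<^sub>j\<close> are distinct and nonzero, so Hermite interpolation prescribes these jets independently: the
  submodule is stable under the action of the algebras on each tensor factor separately.
  Each \<open>W\<^sub>j\<close> has countable dimension over \<open>\<complex>\<close>, hence only scalar endomorphisms (Dixmier), and the
  density theorem makes the submodule stable under all matrix units of \<open>W\<^sub>j\<close>. Matrix units cut a nonzero
  vector down to a pure tensor \<open>v \<otimes> e\<close> with an arbitrary basis vector \<open>e\<close> of the tensor product
  of the \<open>W\<^sub>j\<close>, and simplicity of \<open>V\<close> does the rest.\<close>

section \<open>Separation of Taylor jets\<close>

text \<open>The length of the jets and the power of \<open>t\<close> that kills \<open>V\<close>
  depend on \<open>u\<close>, so the interpolating polynomial is chosen anew for each vector. Once
  the factors \<open>W_j\<close> are split off, their contributions can be subtracted, which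
  recovers \<open>d_m\<close> and \<open>I_m\<close> on \<open>V\<close> alone for every integer
  \<open>m\<close>, although the interpolation used only large positive exponents. Countable
  dimension is a consequence of simplicity: the words in the countably many \<open>d_i\<close> and
  \<open>I_i\<close>, applied to one nonzero vector, span the module. Density is applied to finitely
  many vectors only, because a finitely supported \<open>u\<close> has finitely many distinct slices
  in each tensor direction. That the tensor product is a module at all is a separate matter; it
  comes down to the product and derivative rules for powers of \<open>t + \<lambda>\<close>, that
  is, to Vandermonde convolution.\<close>

lemma coeff_linear_power_binomial:
  "coeff ([:a, 1:] ^ m) i = of_nat (m choose i) * (a::complex) ^ (m - i)"
  by (cases "i \<le> m") (auto simp: coeff_eq_0 degree_linear_power binomial_eq_0 coeff_linear_poly_power)

lemma pcompose_power: "pcompose (p ^ n) q = pcompose p q ^ n" for p q :: "'a::comm_ring_1 poly"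
  by (induction n) (simp_all add: pcompose_mult pcompose_1)

lemma coprime_linear_polys:
  assumes "a \<noteq> (b :: complex)" shows "coprime [:-a, 1:] [:-b, 1:]"
proof (rule coprimeI)
  fix c assume "c dvd [:-a, 1:]" "c dvd [:-b, 1:]"
  then have "c dvd [:-a, 1:] - [:-b, 1:]" by (rule dvd_diff)
  then have "c dvd [:b - a:]" by simp
  moreover have "[:b - a:] dvd 1" using assms by (simp add: is_unit_const_poly_iff dvd_field_iff)
  ultimately show "c dvd 1" by (rule dvd_trans)
qed

locale complex_vector_space = vector_space scale
  for scale :: "complex \<Rightarrow> 'v::ab_group_add \<Rightarrow> 'v" (infixr \<open>*s\<close> 75)
begin

text \<open>The given combination of the \<open>v j i\<close> is the value at \<open>f = t\<^sup>m\<close> of the linear functional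
  that sends \<open>f\<close> to the sum of its \<open>i\<close>-th Taylor coefficients at \<open>lam j\<close> times \<open>v j i\<close>;
  Hermite interpolation by a multiple of a high power of \<open>t\<close> isolates one of the \<open>v j i\<close>.\<close>

lemma jet_separation:
  fixes lam :: "'j \<Rightarrow> complex" and v :: "'j \<Rightarrow> nat \<Rightarrow> 'v"
  assumes U: "subspace U" and J: "finite J" "inj_on lam J" "\<And>j. j \<in> J \<Longrightarrow> lam j \<noteq> 0"
    and jets: "\<And>m. m \<ge> M0 \<Longrightarrow>
      (\<Sum>j\<in>J. \<Sum>i\<le>M. (of_nat (m choose i) * lam j ^ (m - i)) *s v j i) \<in> U"
    and j0: "j0 \<in> J" and i0: "i0 \<le> M"
  shows "v j0 i0 \<in> U"
proof -
  define \<Phi> where "\<Phi> f = (\<Sum>j\<in>J. \<Sum>i\<le>M. coeff (pcompose f [:lam j, 1:]) i *s v j i)" for f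
  have add: "\<Phi> (f + g) = \<Phi> f + \<Phi> g" for f g
    by (simp add: \<Phi>_def pcompose_add scale_left_distrib sum.distrib)
  have smult: "\<Phi> (smult c f) = c *s \<Phi> f" for c f
    by (simp add: \<Phi>_def pcompose_smult scale_sum_right)
  have pow: "\<Phi> ([:0, 1:] ^ m) = (\<Sum>j\<in>J. \<Sum>i\<le>M. (of_nat (m choose i) * lam j ^ (m - i)) *s v j i)" for m
    unfolding \<Phi>_def pcompose_power pcompose_pCons
    by (simp add: coeff_linear_power_binomial pcompose_pCons)
  \<comment> \<open>Multiples of \<open>t^M0\<close> are combinations of monomials
    \<open>t^m\<close> with \<open>m \<ge> M0\<close>. The exponent is generalized because each
    coefficient step raises it by one.\<close>
  have mem: "\<Phi> ([:0, 1:] ^ m * g) \<in> U" if "m \<ge> M0" for m g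
    using that
  proof (induction g arbitrary: m)
    case 0
    show ?case using smult[of 0 0] subspace_0[OF U] by simp
  next
    case (pCons c g)
    have "pCons c g = smult c 1 + [:0, 1:] * g" by (simp add: one_pCons)
    then have "[:0, 1:] ^ m * pCons c g = smult c ([:0, 1:] ^ m) + [:0, 1:] ^ Suc m * g"
      by (simp only: distrib_left mult_smult_left mult_1_left power_Suc mult_ac)
    also have "\<Phi> \<dots> \<in> U" unfolding add smult
      using pCons.IH[of "Suc m"] pCons.prems jets[of m] pow[of m]
      by (intro subspace_add[OF U] subspace_scale[OF U]) auto
    finally show ?case .
  qed
  \<comment> \<open>\<open>P\<close> collects the vanishing conditions: high order at 0, to kill
    \<open>V\<close>, and order \<open>Suc M\<close> at every other point. Multiples of
    \<open>Q\<close> are invisible to the jet at \<open>lam j0\<close>.\<close>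
  define P where "P = [:0, 1:] ^ M0 * (\<Prod>j\<in>J - {j0}. [:-lam j, 1:] ^ Suc M)"
  define Q where "Q = [:-lam j0, 1:] ^ Suc M"
  have "coprime P Q"
  proof -
    have "coprime [:0, 1:] [:-lam j0, 1:]"
      using coprime_linear_polys[of 0 "lam j0"] J(3)[OF j0] by simp
    then have "coprime ([:0, 1:] ^ M0) Q"
      unfolding Q_def using coprime_power_left_iff coprime_power_right_iff by blast
    moreover have "coprime ([:-lam j, 1:] ^ Suc M) Q" if "j \<in> J - {j0}" for j
    proof -
      have "coprime [:-lam j, 1:] [:-lam j0, 1:]"
        using that j0 J(2) by (intro coprime_linear_polys) (auto dest: inj_onD)
      then show ?thesis
        unfolding Q_def using coprime_power_left_iff coprime_power_right_iff by blast
    qed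
    ultimately show ?thesis
      unfolding P_def by (simp only: coprime_mult_left_iff prod_coprime_left)
  qed
  then obtain r s where rs: "r * P + s * Q = 1"
    using bezout_coefficients_fst_snd[of P Q] by (metis coprime_imp_gcd_eq_1)
  \<comment> \<open>By Bezout \<open>r * P\<close> is 1 modulo \<open>Q\<close>, so at
    \<open>lam j0\<close> the polynomial \<open>f\<close> has the jet of
    \<open>(t - lam j0)^i0\<close>, while \<open>P\<close> makes its jets at the other points
    zero.\<close>
  define f where "f = [:-lam j0, 1:] ^ i0 * (r * P)"
  \<comment> \<open>Translation moves the point to the origin, where vanishing to order
    \<open>Suc M\<close> is divisibility by \<open>t^(Suc M)\<close>.\<close>
  have X: "pcompose [:-lam j, 1:] [:lam j, 1:] = [:0, 1:]" for j
    by (simp add: pcompose_pCons)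
  have Xcoeff: "coeff ([:0, 1:] ^ Suc M * g) i = 0" if "i \<le> M" for g :: "complex poly" and i
    using that by (simp add: monom_altdef[of 1, simplified, symmetric] coeff_monom_mult del: power_Suc)
  have other: "coeff (pcompose f [:lam j, 1:]) i = 0" if "j \<in> J" "j \<noteq> j0" "i \<le> M" for j i
  proof -
    have "(\<Prod>j\<in>J - {j0}. [:-lam j, 1:] ^ Suc M)
      = [:-lam j, 1:] ^ Suc M * (\<Prod>j\<in>J - {j0} - {j}. [:-lam j, 1:] ^ Suc M)"
      using that J by (intro prod.remove) auto
    then have "f = [:-lam j, 1:] ^ Suc M * ([:-lam j0, 1:] ^ i0 * r * [:0, 1:] ^ M0
        * (\<Prod>j\<in>J - {j0} - {j}. [:-lam j, 1:] ^ Suc M))"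
      unfolding f_def P_def by (simp only: mult_ac)
    then show ?thesis
      using that(3) by (simp only: pcompose_mult pcompose_power X Xcoeff)
  qed
  have "f = [:-lam j0, 1:] ^ i0 - [:-lam j0, 1:] ^ Suc M * (s * [:-lam j0, 1:] ^ i0)"
  proof -
    have "r * P = 1 - s * Q" using rs by (simp add: eq_diff_eq)
    then show ?thesis unfolding f_def Q_def by (simp only: right_diff_distrib mult_1_left mult_1_right mult_ac)
  qed
  then have "pcompose f [:lam j0, 1:] = [:0, 1:] ^ i0
      - [:0, 1:] ^ Suc M * pcompose (s * [:-lam j0, 1:] ^ i0) [:lam j0, 1:]"
    by (simp only: pcompose_diff pcompose_mult pcompose_power X)
  then have this_coeff: "coeff (pcompose f [:lam j0, 1:]) i = (if i = i0 then 1 else 0)" if "i \<le> M" for i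
    using that by (simp only: coeff_diff Xcoeff)
      (simp add: monom_altdef[of 1, simplified, symmetric])
  have "\<Phi> f = (\<Sum>j\<in>J. if j = j0 then \<Sum>i\<le>M. (if i = i0 then 1 else 0) *s v j0 i else 0)"
    unfolding \<Phi>_def by (intro sum.cong refl) (auto simp: other this_coeff)
  also have "\<dots> = v j0 i0"
    using J j0 i0 by (simp add: if_distrib[of "\<lambda>c. c *s _"] cong: if_cong)
  finally have "\<Phi> f = v j0 i0" .
  moreover have f: "f = [:0, 1:] ^ M0 * ([:-lam j0, 1:] ^ i0 * r * (\<Prod>j\<in>J - {j0}. [:-lam j, 1:] ^ Suc M))"
    unfolding f_def P_def by (simp only: mult_ac)
  have "\<Phi> f \<in> U" unfolding f by (rule mem) (rule order_refl)
  ultimately show ?thesis by simp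
qed
end

section \<open>Schur's lemma and the density theorem in countable dimension\<close>

text \<open>Linearity is required only on \<open>W\<close>, because the operators of a module are
  controlled only on finitely supported functions and are arbitrary elsewhere.\<close>

locale simple_operator_module = complex_vector_space scale
  for scale :: "complex \<Rightarrow> 'v::ab_group_add \<Rightarrow> 'v" (infixr \<open>*s\<close> 75) +
  fixes W :: "'v set" and G :: "('v \<Rightarrow> 'v) set"
  assumes subspace_W: "subspace W"
    and nonzero_W: "\<exists>v\<in>W. v \<noteq> 0"
    and countable_G: "countable G"
    and G_closed: "\<And>g x. g \<in> G \<Longrightarrow> x \<in> W \<Longrightarrow> g x \<in> W"
    and G_add: "\<And>g x y. g \<in> G \<Longrightarrow> x \<in> W \<Longrightarrow> y \<in> W \<Longrightarrow> g (x + y) = g x + g y"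
    and G_scale: "\<And>g c x. g \<in> G \<Longrightarrow> x \<in> W \<Longrightarrow> g (c *s x) = c *s g x"
    and irreducible: "\<And>U. subspace U \<Longrightarrow> U \<subseteq> W \<Longrightarrow> (\<And>g x. g \<in> G \<Longrightarrow> x \<in> U \<Longrightarrow> g x \<in> U)
      \<Longrightarrow> U = {0} \<or> U = W"
begin

lemmas W_zero = subspace_0[OF subspace_W]
  and W_add = subspace_add[OF subspace_W]
  and W_scale = subspace_scale[OF subspace_W]
  and W_diff = subspace_diff[OF subspace_W]

lemma G_zero: "g \<in> G \<Longrightarrow> g 0 = 0"
  using G_scale[of g 0 0] W_zero by simp

lemma G_diff: "g \<in> G \<Longrightarrow> x \<in> W \<Longrightarrow> y \<in> W \<Longrightarrow> g (x - y) = g x - g y"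
  using G_add[of g "x - y" y] W_diff by (simp add: eq_diff_eq)

definition lin_on_W :: "('v \<Rightarrow> 'v) \<Rightarrow> bool" where
  "lin_on_W f \<longleftrightarrow> (\<forall>x\<in>W. f x \<in> W) \<and> (\<forall>x\<in>W. \<forall>y\<in>W. f (x + y) = f x + f y)
     \<and> (\<forall>c. \<forall>x\<in>W. f (c *s x) = c *s f x)"

lemma lin_on_W_zero: "lin_on_W f \<Longrightarrow> f 0 = 0"
  unfolding lin_on_W_def using W_zero by (metis scale_zero_left)

lemma lin_on_W_diff:
  assumes "lin_on_W f" "x \<in> W" "y \<in> W" shows "f (x - y) = f x - f y"
proof -
  have "f (x - y + y) = f (x - y) + f y"
    using assms W_diff unfolding lin_on_W_def by blast
  then show ?thesis by simp
qed

lemma lin_on_W_sum: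
  assumes "lin_on_W f" "\<And>i. i \<in> I \<Longrightarrow> v i \<in> W"
  shows "f (\<Sum>i\<in>I. v i) = (\<Sum>i\<in>I. f (v i))"
  using assms(2)
proof (induction I rule: infinite_finite_induct)
  case (insert i I)
  then have "(\<Sum>i\<in>I. v i) \<in> W" by (auto intro: subspace_sum[OF subspace_W])
  then show ?case using insert assms(1) unfolding lin_on_W_def by simp
qed (simp_all add: lin_on_W_zero[OF assms(1)])

text \<open>A spanning set of the cyclic submodule generated by \<open>v\<close>; it is the source
  of countable dimension.\<close>

inductive_set word_orbit :: "'v \<Rightarrow> 'v set" for v where
  base: "v \<in> word_orbit v"
| step: "g \<in> G \<Longrightarrow> x \<in> word_orbit v \<Longrightarrow> g x \<in> word_orbit v"

lemma word_orbit_W: "x \<in> word_orbit v \<Longrightarrow> v \<in> W \<Longrightarrow> x \<in> W"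
  by (induction rule: word_orbit.induct) (auto intro: G_closed)

lemma countable_word_orbit: "countable (word_orbit v)"
proof -
  have "word_orbit v \<subseteq> (\<lambda>gs. foldr (\<lambda>g x. g x) gs v) ` lists G"
  proof
    fix x assume "x \<in> word_orbit v"
    then show "x \<in> (\<lambda>gs. foldr (\<lambda>g x. g x) gs v) ` lists G"
    proof induction
      case base
      show ?case by (rule image_eqI[of _ _ "[]"]) auto
    next
      case (step g x)
      then obtain gs where "gs \<in> lists G" "x = foldr (\<lambda>g x. g x) gs v" by blast
      then show ?case using step(1) by (intro image_eqI[of _ _ "g # gs"]) auto
    qed
  qed
  then show ?thesis
    using countable_G by (meson countable_subset countable_image countable_lists)
qed

lemma span_word_orbit:
  assumes "v \<in> W" "v \<noteq> 0" shows "span (word_orbit v) = W"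
proof -
  have sub: "span (word_orbit v) \<subseteq> W"
    using word_orbit_W assms(1) by (intro span_minimal subspace_W) auto
  \<comment> \<open>Membership in \<open>W\<close> is carried along because \<open>g\<close> is
    additive only there.\<close>
  have "x \<in> W \<and> g x \<in> span (word_orbit v)" if g: "g \<in> G" and x: "x \<in> span (word_orbit v)" for g x
    using x
  proof (induction rule: span_induct_alt)
    case base then show ?case by (simp add: G_zero g span_zero W_zero)
  next
    case (step c x y)
    then have "x \<in> W" "y \<in> W" using word_orbit_W assms(1) by auto
    then have "c *s x + y \<in> W" "g (c *s x + y) = c *s g x + g y"
      by (simp_all add: G_add G_scale g W_scale W_add)
    then show ?case using step g
      by (simp add: span_add span_scale span_base word_orbit.step)
  qed
  then have "span (word_orbit v) = {0} \<or> span (word_orbit v) = W"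
    by (intro irreducible sub) auto
  moreover have "v \<in> span (word_orbit v)" by (simp add: span_base word_orbit.base)
  ultimately show ?thesis using assms by blast
qed


section \<open>Polynomials in one endomorphism and independence of resolvents\<close>

lemma lin_on_W_funpow: "lin_on_W f \<Longrightarrow> lin_on_W (f ^^ n)"
  by (induction n) (auto simp: lin_on_W_def)

definition poly_op :: "('v \<Rightarrow> 'v) \<Rightarrow> complex poly \<Rightarrow> 'v \<Rightarrow> 'v" where
  "poly_op f p x = (\<Sum>i\<le>degree p. coeff p i *s (f ^^ i) x)"

lemma poly_op_bound:
  assumes "degree p \<le> N" shows "poly_op f p x = (\<Sum>i\<le>N. coeff p i *s (f ^^ i) x)"
  unfolding poly_op_def using assms
  by (intro sum.mono_neutral_left) (auto simp: coeff_eq_0)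

lemma poly_op_0: "poly_op f 0 x = 0"
  by (simp add: poly_op_def)

lemma poly_op_add: "poly_op f (p + q) x = poly_op f p x + poly_op f q x"
proof -
  let ?N = "max (degree p) (degree q)"
  have "degree (p + q) \<le> ?N" by (rule degree_add_le_max)
  then show ?thesis
    by (simp add: poly_op_bound[of _ ?N] scale_left_distrib sum.distrib)
qed

lemma poly_op_smult: "poly_op f (smult c p) x = c *s poly_op f p x"
  by (simp add: poly_op_bound[of _ "degree p"] degree_smult_le scale_sum_right)

lemma poly_op_sum: "poly_op f (\<Sum>i\<in>I. p i) x = (\<Sum>i\<in>I. poly_op f (p i) x)"
  by (induction I rule: infinite_finite_induct) (simp_all add: poly_op_0 poly_op_add)

lemma lin_on_W_poly_op:
  assumes "lin_on_W f" shows "lin_on_W (poly_op f p)"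
proof -
  have pow: "(f ^^ i) x \<in> W" "(f ^^ i) (x + y) = (f ^^ i) x + (f ^^ i) y"
    "(f ^^ i) (c *s x) = c *s (f ^^ i) x" if "x \<in> W" "y \<in> W" for i x y c
    using lin_on_W_funpow[OF assms, of i] that unfolding lin_on_W_def by blast+
  show ?thesis
    unfolding lin_on_W_def poly_op_def
    by (auto simp: pow sum.distrib scale_right_distrib scale_sum_right mult.commute
        intro!: subspace_sum[OF subspace_W] W_scale sum.cong)
qed

text \<open>Peels off one linear factor and lets it act first; removing a root and cancelling a
  resolvent both use this form.\<close>

lemma poly_op_linear_factor:
  assumes "lin_on_W f" "x \<in> W"
  shows "poly_op f ([:-a, 1:] * q) x = poly_op f q (f x - a *s x)"
proof -
  have "poly_op f (pCons 0 q) x = (\<Sum>i\<le>Suc (degree q). coeff (pCons 0 q) i *s (f ^^ i) x)"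
    by (intro poly_op_bound) (simp add: degree_pCons_le)
  also have "\<dots> = poly_op f q (f x)"
    by (simp add: sum.atMost_Suc_shift poly_op_def funpow_swap1 del: sum.atMost_Suc)
  finally have shift: "poly_op f (pCons 0 q) x = poly_op f q (f x)" .
  have "[:-a, 1:] * q = pCons 0 q + smult (-a) q" by simp
  then have "poly_op f ([:-a, 1:] * q) x = poly_op f q (f x) - a *s poly_op f q x"
    by (simp only: poly_op_add poly_op_smult shift) simp
  also have "\<dots> = poly_op f q (f x - a *s x)"
    using lin_on_W_diff[OF lin_on_W_poly_op[OF assms(1)], of "f x" "a *s x" q] assms
      lin_on_W_poly_op[OF assms(1), of q] unfolding lin_on_W_def by (simp add: W_scale)
  finally show ?thesis .
qed

text \<open>Over \<complex> the polynomial splits into factors \<open>f - a\<close>, each injective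
  when \<open>f\<close> has no eigenvector. The induction removes one root at a time.\<close>

lemma poly_op_injective:
  assumes f: "lin_on_W f" and inj: "\<And>c x. x \<in> W \<Longrightarrow> f x = c *s x \<Longrightarrow> x = 0"
    and "p \<noteq> 0" "x \<in> W" "poly_op f p x = 0"
  shows "x = 0"
  using assms(3-5)
proof (induction "degree p" arbitrary: p x rule: less_induct)
  case less
  show ?case
  proof (cases "degree p = 0")
    case True
    then obtain a where "p = [:a:]" by (metis degree_eq_zeroE)
    then show ?thesis using less.prems by (simp add: poly_op_def)
  next
    case False
    then obtain a where "poly p a = 0"
      using fundamental_theorem_of_algebra[of p] by (auto simp: constant_degree)
    then obtain q where q: "p = [:-a, 1:] * q" by (auto simp: poly_eq_0_iff_dvd elim: dvdE)
    then have "q \<noteq> 0" using less.prems(1) by auto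
    moreover have "degree q < degree p" using \<open>q \<noteq> 0\<close> by (simp add: q degree_mult_eq del: mult_pCons_left)
    moreover have "f x - a *s x \<in> W"
      using f less.prems(2) unfolding lin_on_W_def by (simp add: W_diff W_scale)
    moreover have "poly_op f q (f x - a *s x) = 0"
      using less.prems(3) poly_op_linear_factor[OF f less.prems(2)] unfolding q by metis
    ultimately have "f x - a *s x = 0"
      using less.hyps by blast
    then show ?thesis using inj[OF less.prems(2), of a] by simp
  qed
qed

text \<open>Think of \<open>x c\<close> as \<open>1/(f - c)\<close> applied to \<open>v\<close>.
  Clearing denominators turns a linear relation into \<open>p(f) v = 0\<close> for the numerator
  \<open>p\<close> of a sum of partial fractions; then \<open>p = 0\<close>, and evaluating
  \<open>p\<close> at one pole isolates one coefficient.\<close>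

lemma resolvent_independent:
  assumes f: "lin_on_W f" and inj: "\<And>c x. x \<in> W \<Longrightarrow> f x = c *s x \<Longrightarrow> x = 0"
    and v: "v \<in> W" "v \<noteq> 0" and x: "\<And>c. x c \<in> W" "\<And>c. f (x c) - c *s x c = v"
    and S: "finite S"
  shows "independent (x ` S)" "inj x"
proof -
  show injx: "inj x"
  proof (rule injI)
    fix a b assume eq: "x a = x b"
    have "f (x a) - a *s x a = f (x a) - b *s x a" using x(2)[of a] x(2)[of b] eq by simp
    then have "a *s x a = b *s x a" by simp
    moreover have "x a \<noteq> 0" using x(2)[of a] v lin_on_W_zero[OF f] by auto
    ultimately show "a = b" by simp
  qed
  show "independent (x ` S)"
  proof (rule independent_if_scalars_zero)
    show "finite (x ` S)" using S by simp
    fix u y assume "(\<Sum>y\<in>x ` S. u y *s y) = 0" and "y \<in> x ` S"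
    then obtain c where c: "c \<in> S" "y = x c" and sum0: "(\<Sum>a\<in>S. u (x a) *s x a) = 0"
      using injx by (auto simp: sum.reindex inj_on_subset)
    \<comment> \<open>The common denominator without its factor at \<open>a\<close>: on
      \<open>S\<close> it vanishes everywhere except at \<open>a\<close>.\<close>
    define r where "r a = (\<Prod>b\<in>S - {a}. [:-b, 1:])" for a :: complex
    have lin: "lin_on_W (poly_op f (\<Prod>b\<in>S. [:-b, 1:]))" by (rule lin_on_W_poly_op[OF f])
    have r: "poly_op f (\<Prod>b\<in>S. [:-b, 1:]) (u (x a) *s x a) = poly_op f (smult (u (x a)) (r a)) v"
      if "a \<in> S" for a
    proof -
      have "(\<Prod>b\<in>S. [:-b, 1:]) = [:-a, 1:] * r a"
        unfolding r_def using S that by (rule prod.remove)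
      then show ?thesis
        using lin x(1) poly_op_linear_factor[OF f x(1)[of a], of a "r a"] x(2)[of a]
        unfolding lin_on_W_def by (simp only: poly_op_smult)
    qed
    have "0 = poly_op f (\<Prod>b\<in>S. [:-b, 1:]) (\<Sum>a\<in>S. u (x a) *s x a)"
      by (simp add: sum0 lin_on_W_zero lin)
    also have "\<dots> = (\<Sum>a\<in>S. poly_op f (\<Prod>b\<in>S. [:-b, 1:]) (u (x a) *s x a))"
      using lin x(1) by (intro lin_on_W_sum) (auto simp: W_scale)
    also have "\<dots> = poly_op f (\<Sum>a\<in>S. smult (u (x a)) (r a)) v"
      by (simp add: r poly_op_sum)
    finally have zero: "poly_op f (\<Sum>a\<in>S. smult (u (x a)) (r a)) v = 0" by (rule sym)
    have "(\<Sum>a\<in>S. smult (u (x a)) (r a)) = 0"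
    proof (rule ccontr)
      assume ne: "(\<Sum>a\<in>S. smult (u (x a)) (r a)) \<noteq> 0"
      have "v = 0"
        by (rule poly_op_injective[OF f _ ne v(1) zero], rule inj)
      with v(2) show False by simp
    qed
    then have "poly (\<Sum>a\<in>S. smult (u (x a)) (r a)) c = 0" by (simp only: poly_0)
    then have "0 = (\<Sum>a\<in>S. u (x a) * poly (r a) c)" by (simp add: poly_sum)
    also have "\<dots> = (\<Sum>a\<in>{c}. u (x a) * poly (r a) c)"
      using S c by (intro sum.mono_neutral_right) (auto simp: r_def poly_prod)
    finally have "u (x c) * poly (r c) c = 0" by simp
    moreover have "poly (r c) c \<noteq> 0" using S by (simp add: r_def poly_prod)
    ultimately show "u y = 0" using c by simp
  qed
qed

text \<open>Writes a space of countable dimension as an increasing union of finite-dimensional ones,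
  as the counting argument below requires.\<close>

lemma span_range_nat:
  assumes "x \<in> span (range (e :: nat \<Rightarrow> 'v))"
  shows "\<exists>n. x \<in> span (e ` {..<n})"
  using assms
proof (induction rule: span_induct_alt)
  case base then show ?case by (simp add: span_zero)
next
  case (step c x y)
  then obtain n m where n: "y \<in> span (e ` {..<n})" and m: "x = e m" by auto
  have "y \<in> span (e ` {..<max n (Suc m)})"
    by (rule subsetD[OF span_mono n]) auto
  moreover have "x \<in> span (e ` {..<max n (Suc m)})"
    by (rule span_base) (auto simp: m)
  ultimately show ?case by (meson span_add span_scale)
qed

text \<open>Dixmier's argument: a non-scalar endomorphism would have an everywhere defined resolvent,
  whose values at one vector form an uncountable independent family in a space of countable dimension.\<close>

lemma schur:
  assumes f: "lin_on_W f" and comm: "\<And>g x. g \<in> G \<Longrightarrow> x \<in> W \<Longrightarrow> f (g x) = g (f x)"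
  shows "\<exists>c. \<forall>x\<in>W. f x = c *s x"
proof (rule ccontr)
  assume nonscalar: "\<nexists>c. \<forall>x\<in>W. f x = c *s x"
  have fW: "f x \<in> W" "f (x + y) = f x + f y" "f (c *s x) = c *s f x"
    if "x \<in> W" "y \<in> W" for x y c
    using f that unfolding lin_on_W_def by blast+
  \<comment> \<open>Each eigenspace is a submodule, and it is not all of \<open>W\<close> because
    \<open>f\<close> is not scalar.\<close>
  have ker: "x = 0" if "x \<in> W" "f x = c *s x" for c x
  proof -
    have "{x \<in> W. f x = c *s x} = {0} \<or> {x \<in> W. f x = c *s x} = W"
      by (rule irreducible)
         (auto simp: subspace_def W_zero W_add W_scale fW lin_on_W_zero[OF f] scale_right_distrib
           scale_left_commute comm G_closed G_scale mult.commute)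
    then show ?thesis using nonscalar that by blast
  qed
  \<comment> \<open>The range of \<open>f - c\<close> is a submodule; if it were zero,
    \<open>f\<close> would be the scalar \<open>c\<close>.\<close>
  have im: "\<exists>x\<in>W. f x - c *s x = v" if "v \<in> W" for c v
  proof -
    let ?R = "(\<lambda>x. f x - c *s x) ` W"
    have "?R = {0} \<or> ?R = W"
    proof (rule irreducible)
      show "subspace ?R"
      proof (rule subspaceI)
        show "0 \<in> ?R" using W_zero lin_on_W_zero[OF f] by force
        show "x + y \<in> ?R" if xy: "x \<in> ?R" "y \<in> ?R" for x y
        proof -
          obtain x' y' where "x' \<in> W" "y' \<in> W" "x = f x' - c *s x'" "y = f y' - c *s y'"
            using xy by blast
          then show ?thesis
            by (intro image_eqI[of _ _ "x' + y'"]) (auto simp: fW W_add scale_right_distrib)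
        qed
        show "a *s x \<in> ?R" if x: "x \<in> ?R" for a x
        proof -
          obtain x' where "x' \<in> W" "x = f x' - c *s x'" using x by blast
          then show ?thesis
            by (intro image_eqI[of _ _ "a *s x'"])
               (auto simp: fW W_scale scale_right_diff_distrib mult.commute)
        qed
      qed
      show "?R \<subseteq> W" by (auto simp: fW W_scale W_diff)
      show "g x \<in> ?R" if gx: "g \<in> G" "x \<in> ?R" for g x
      proof -
        obtain x' where "x' \<in> W" "x = f x' - c *s x'" using gx by blast
        then show ?thesis using gx(1)
          by (intro image_eqI[of _ _ "g x'"]) (auto simp: comm G_diff G_scale fW W_scale G_closed)
      qed
    qed
    moreover have "?R \<noteq> {0}"
    proof
      assume "?R = {0}"
      have "f x = c *s x" if "x \<in> W" for x
      proof -
        have "f x - c *s x \<in> ?R" using that by (rule imageI)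
        then show ?thesis unfolding \<open>?R = {0}\<close> by simp
      qed
      then show False using nonscalar by blast
    qed
    ultimately have "v \<in> ?R" using that by simp
    then show ?thesis by blast
  qed
  obtain v where v: "v \<in> W" "v \<noteq> 0" using nonzero_W by blast
  obtain x where x: "\<And>c. x c \<in> W" "\<And>c. f (x c) - c *s x c = v" using im[OF v(1)] by metis
  define e where "e = from_nat_into (word_orbit v)"
  have "range e = word_orbit v" unfolding e_def
    using countable_word_orbit word_orbit.base by (intro range_from_nat_into) auto
  then have cover: "\<exists>n. x c \<in> span (e ` {..<n})" for c
    using span_range_nat span_word_orbit[OF v] x(1) by metis
  \<comment> \<open>Uncountably many parameters \<open>c\<close> fall into countably many spans, so
    one span of at most \<open>n\<close> dimensions receives infinitely many resolvent values, in
    particular \<open>n + 1\<close> independent ones.\<close>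
  have "\<exists>n. infinite {c. x c \<in> span (e ` {..<n})}"
  proof (rule ccontr)
    assume "\<nexists>n. infinite {c. x c \<in> span (e ` {..<n})}"
    then have "countable (\<Union>n. {c. x c \<in> span (e ` {..<n})})"
      by (intro countable_UN) (simp_all add: countable_finite)
    moreover have "(\<Union>n. {c. x c \<in> span (e ` {..<n})}) = UNIV" using cover by auto
    ultimately show False using uncountable_UNIV_complex by simp
  qed
  then obtain n where "infinite {c. x c \<in> span (e ` {..<n})}" ..
  then obtain S where S: "S \<subseteq> {c. x c \<in> span (e ` {..<n})}" "card S = Suc n" "finite S"
    by (meson infinite_arbitrarily_large)
  have ind: "independent (x ` S)" "inj x"
    by (rule resolvent_independent[OF f _ v x S(3)], rule ker; assumption)+
  have "card (x ` S) \<le> card (e ` {..<n})"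
    using independent_span_bound[OF _ ind(1), of "e ` {..<n}"] S(1) by blast
  also have "\<dots> \<le> n" using card_image_le[of "{..<n}" e] by simp
  finally show False using S ind(2) by (simp add: card_image inj_on_subset)
qed

section \<open>The generated algebra and Jacobson density\<close>

inductive_set alg :: "('v \<Rightarrow> 'v) set" where
  alg_id: "(\<lambda>x. x) \<in> alg"
| alg_G: "g \<in> G \<Longrightarrow> a \<in> alg \<Longrightarrow> (\<lambda>x. g (a x)) \<in> alg"
| alg_add: "a \<in> alg \<Longrightarrow> b \<in> alg \<Longrightarrow> (\<lambda>x. a x + b x) \<in> alg"
| alg_scale: "a \<in> alg \<Longrightarrow> (\<lambda>x. c *s a x) \<in> alg"

lemma lin_on_W_alg: "a \<in> alg \<Longrightarrow> lin_on_W a"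
proof (induction rule: alg.induct)
  case (alg_add a b)
  then show ?case unfolding lin_on_W_def by (auto simp: W_add scale_right_distrib algebra_simps)
next
  case (alg_scale a c)
  then show ?case unfolding lin_on_W_def by (auto simp: W_scale scale_right_distrib mult.commute)
qed (auto simp: lin_on_W_def G_closed G_add G_scale)

lemma alg_W: "a \<in> alg \<Longrightarrow> x \<in> W \<Longrightarrow> a x \<in> W"
  using lin_on_W_alg unfolding lin_on_W_def by blast

definition ann :: "'v set \<Rightarrow> ('v \<Rightarrow> 'v) set" where
  "ann S = {a \<in> alg. \<forall>s\<in>S. a s = 0}"

text \<open>The annihilator of \<open>S\<close> is a left ideal, so its orbit through
  \<open>w\<close> is a submodule.\<close>

lemma ann_orbit_cases:
  assumes "w \<in> W"
  shows "(\<forall>a\<in>ann S. a w = 0) \<or> (\<lambda>a. a w) ` ann S = W"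
proof -
  let ?U = "(\<lambda>a. a w) ` ann S"
  have "?U = {0} \<or> ?U = W"
  proof (rule irreducible)
    show "subspace ?U"
    proof (rule subspaceI)
      have "(\<lambda>x. 0 *s x) \<in> ann S" unfolding ann_def using alg_scale[OF alg_id, of 0] by auto
      then show "0 \<in> ?U" by (force intro: image_eqI)
      show "x + y \<in> ?U" if xy: "x \<in> ?U" "y \<in> ?U" for x y
      proof -
        obtain a b where "a \<in> ann S" "b \<in> ann S" "x = a w" "y = b w" using xy by blast
        then show ?thesis by (intro image_eqI[of _ _ "\<lambda>x. a x + b x"]) (auto simp: ann_def alg_add)
      qed
      show "c *s x \<in> ?U" if x: "x \<in> ?U" for c x
      proof -
        obtain a where "a \<in> ann S" "x = a w" using x by blast
        then show ?thesis by (intro image_eqI[of _ _ "\<lambda>x. c *s a x"]) (auto simp: ann_def alg_scale)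
      qed
    qed
    show "?U \<subseteq> W" using assms by (auto simp: ann_def alg_W)
    show "g x \<in> ?U" if x: "g \<in> G" "x \<in> ?U" for g x
    proof -
      obtain a where "a \<in> ann S" "x = a w" using x by blast
      then show ?thesis using x(1)
        by (intro image_eqI[of _ _ "\<lambda>x. g (a x)"]) (auto simp: ann_def alg_G G_zero)
    qed
  qed
  then show ?thesis by blast
qed

text \<open>In the essential case of the induction \<open>ann S\<close> moves \<open>s\<close> onto
  all of \<open>W\<close>. Then \<open>a s \<mapsto> a w\<close> is an endomorphism commuting with
  \<open>G\<close>, hence a scalar \<open>c\<close> by Schur, and \<open>ann S\<close> kills
  \<open>w - c *s s\<close>, to which the induction hypothesis applies.\<close>

lemma double_annihilator:
  assumes "finite S" "S \<subseteq> W" "w \<in> W" "\<And>a. a \<in> ann S \<Longrightarrow> a w = 0"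
  shows "w \<in> span S"
  using assms
proof (induction S arbitrary: w rule: finite_induct)
  case empty
  then show ?case using alg_id by (auto simp: ann_def)
next
  case (insert s S)
  show ?case
  proof (cases "\<forall>a\<in>ann S. a s = 0")
    case True
    then have "ann (insert s S) = ann S" by (auto simp: ann_def)
    then have "w \<in> span S" using insert.IH[of w] insert.prems by simp
    then show ?thesis using span_mono[of S "insert s S"] by auto
  next
    case False
    then have onto: "(\<lambda>a. a s) ` ann S = W" using ann_orbit_cases[of s S] insert.prems by auto
    \<comment> \<open>The choice of \<open>a\<close> is immaterial: two elements of
      \<open>ann S\<close> that agree on \<open>s\<close> differ by an element of
      \<open>ann (insert s S)\<close>, which kills \<open>w\<close>.\<close>
    define f where "f y = (SOME a. a \<in> ann S \<and> a s = y) w" for y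
    have f: "f (a s) = a w" if a: "a \<in> ann S" for a
    proof -
      let ?b = "SOME b. b \<in> ann S \<and> b s = a s"
      have b: "?b \<in> ann S \<and> ?b s = a s" by (rule someI[of _ a]) (simp add: a)
      have "(\<lambda>x. ?b x + (-1) *s a x) \<in> alg"
        using a b by (intro alg_add alg_scale) (auto simp: ann_def)
      then have "(\<lambda>x. ?b x + (-1) *s a x) \<in> ann (insert s S)"
        using a b by (auto simp: ann_def)
      then have "?b w + (-1) *s a w = 0" using insert.prems(3) by blast
      then show ?thesis by (simp add: f_def)
    qed
    have pre: "\<exists>a\<in>ann S. y = a s" if "y \<in> W" for y using onto that by blast
    have "lin_on_W f"
      unfolding lin_on_W_def
    proof (intro conjI ballI allI)
      fix x assume "x \<in> W"
      then obtain a where a: "a \<in> ann S" "x = a s" using pre by blast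
      then show "f x \<in> W" using f insert.prems by (simp add: ann_def alg_W)
      fix c
      have "(\<lambda>x. c *s a x) \<in> ann S" using a by (auto simp: ann_def alg_scale)
      from f[OF this] show "f (c *s x) = c *s f x" using a f by simp
    next
      fix x y assume "x \<in> W" "y \<in> W"
      then obtain a b where a: "a \<in> ann S" "x = a s" and b: "b \<in> ann S" "y = b s" using pre by metis
      have "(\<lambda>x. a x + b x) \<in> ann S" using a b by (auto simp: ann_def alg_add)
      from f[OF this] show "f (x + y) = f x + f y" using a b f by simp
    qed
    moreover have "f (g x) = g (f x)" if gx: "g \<in> G" "x \<in> W" for g x
    proof -
      obtain a where a: "a \<in> ann S" "x = a s" using pre gx by blast
      have "(\<lambda>x. g (a x)) \<in> ann S" using a gx by (auto simp: ann_def alg_G G_zero)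
      from f[OF this] show ?thesis using a f by simp
    qed
    ultimately obtain c where c: "\<And>x. x \<in> W \<Longrightarrow> f x = c *s x" using schur by blast
    have sw: "s \<in> W" "S \<subseteq> W" using insert.prems by auto
    have "a (w - c *s s) = 0" if a: "a \<in> ann S" for a
    proof -
      have lin: "lin_on_W a" and "a s \<in> W" using a sw by (auto simp: ann_def lin_on_W_alg alg_W)
      then have "a w = c *s a s" using c f a by metis
      moreover have "a (w - c *s s) = a w - c *s a s"
        using lin_on_W_diff[OF lin insert.prems(2) W_scale[OF sw(1)]] lin sw
        unfolding lin_on_W_def by simp
      ultimately show ?thesis by simp
    qed
    then have "w - c *s s \<in> span S" using insert.prems(2) sw
      by (intro insert.IH W_diff W_scale)
    then have "w - c *s s \<in> span (insert s S)" using span_mono[of S "insert s S"] by auto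
    moreover have "c *s s \<in> span (insert s S)" by (simp add: span_base span_scale)
    ultimately have "w - c *s s + c *s s \<in> span (insert s S)" by (rule span_add)
    then show ?thesis by (simp only: diff_add_cancel)
  qed
qed

text \<open>An element correct on \<open>S\<close> is corrected at \<open>s\<close> by adding one
  from \<open>ann S\<close>. If \<open>ann S\<close> kills \<open>s\<close>, then \<open>s\<close>
  lies in the span of \<open>S\<close> and linearity already gives the right value.\<close>

theorem density:
  assumes "lin_on_W F" "finite S" "S \<subseteq> W"
  shows "\<exists>a\<in>alg. \<forall>w\<in>S. a w = F w"
  using assms(2,3)
proof (induction S rule: finite_induct)
  case empty
  then show ?case using alg_id by blast
next
  case (insert s S)
  have s: "s \<in> W" and SW: "S \<subseteq> W" using insert.prems by auto
  obtain a where a: "a \<in> alg" "\<forall>w\<in>S. a w = F w" using insert.IH[OF SW] by blast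
  show ?case
  proof (cases "\<forall>b\<in>ann S. b s = 0")
    case True
    then have "s \<in> span S" using double_annihilator[OF insert.hyps(1) SW s] by blast
    then have "s \<in> W \<and> a s = F s"
    proof (induction rule: span_induct_alt)
      case base
      then show ?case using lin_on_W_zero assms(1) lin_on_W_alg[OF a(1)] W_zero by metis
    next
      case (step c x y)
      then have "x \<in> W" "a x = F x" using SW a by auto
      then show ?case using step assms(1) lin_on_W_alg[OF a(1)]
        unfolding lin_on_W_def by (simp add: W_add W_scale)
    qed
    then show ?thesis using a by blast
  next
    case False
    have "F s - a s \<in> W" using assms(1) s a alg_W unfolding lin_on_W_def by (simp add: W_diff)
    then obtain b where b: "b \<in> ann S" "F s - a s = b s"
      using ann_orbit_cases[OF s, of S] False by blast
    have ab: "(\<lambda>x. a x + b x) \<in> alg" using a b by (simp add: ann_def alg_add)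
    moreover have "\<forall>w\<in>insert s S. a w + b w = F w"
      using a b(1) b(2)[symmetric] by (auto simp: ann_def)
    ultimately show ?thesis by (intro bexI[OF _ ab])
  qed
qed

end

section \<open>The shifted action\<close>

lemma fsupp_zero: "(\<lambda>_. 0) \<in> fsupp B"
  by (simp add: fsupp_def)

lemma fsupp_add: "f \<in> fsupp B \<Longrightarrow> g \<in> fsupp B \<Longrightarrow> (\<lambda>b. f b + g b) \<in> fsupp B"
proof -
  have "{b. f b + g b \<noteq> 0} \<subseteq> {b. f b \<noteq> 0} \<union> {b. g b \<noteq> 0}" by auto
  then show "f \<in> fsupp B \<Longrightarrow> g \<in> fsupp B \<Longrightarrow> (\<lambda>b. f b + g b) \<in> fsupp B"
    unfolding fsupp_def by (auto intro: finite_subset)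
qed

lemma fsupp_scale: "f \<in> fsupp B \<Longrightarrow> (\<lambda>b. c * f b) \<in> fsupp B"
  unfolding fsupp_def by (auto intro: finite_subset[of _ "{b. f b \<noteq> 0}"] dest!: subsetD)

lemma fsupp_sum:
  assumes "\<And>i. i \<in> I \<Longrightarrow> f i \<in> fsupp B" shows "(\<lambda>b. \<Sum>i\<in>I. c i * f i b) \<in> fsupp B"
  using assms
  by (induction I rule: infinite_finite_induct) (auto intro!: fsupp_zero fsupp_add fsupp_scale)

lemma fsupp_delta: "b \<in> B \<Longrightarrow> delta b \<in> fsupp B"
  by (auto simp: fsupp_def delta_def)

lemma fsupp_finite: "f \<in> fsupp B \<Longrightarrow> finite {b. f b \<noteq> 0}"
  and fsupp_outside: "f \<in> fsupp B \<Longrightarrow> b \<notin> B \<Longrightarrow> f b = 0"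
  by (auto simp: fsupp_def)

lemma endo_onD:
  assumes "endo_on (fsupp B) \<phi>"
  shows endo_closed: "f \<in> fsupp B \<Longrightarrow> \<phi> f \<in> fsupp B"
    and endo_add: "f \<in> fsupp B \<Longrightarrow> g \<in> fsupp B \<Longrightarrow> \<phi> (\<lambda>b. f b + g b) = (\<lambda>b. \<phi> f b + \<phi> g b)"
    and endo_scale: "f \<in> fsupp B \<Longrightarrow> \<phi> (\<lambda>b. c * f b) = (\<lambda>b. c * \<phi> f b)"
  using assms unfolding endo_on_def by blast+

lemma endo_zero: "endo_on (fsupp B) \<phi> \<Longrightarrow> \<phi> (\<lambda>_. 0) = (\<lambda>_. 0)"
  using endo_scale[of B \<phi> "\<lambda>_. 0" 0] by (simp add: fsupp_zero)

lemma endo_sum: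
  assumes "endo_on (fsupp B) \<phi>" and "\<And>i. i \<in> I \<Longrightarrow> f i \<in> fsupp B"
  shows "\<phi> (\<lambda>b. \<Sum>i\<in>I. c i * f i b) = (\<lambda>b. \<Sum>i\<in>I. c i * \<phi> (f i) b)"
  using assms(2)
  by (induction I rule: infinite_finite_induct)
     (simp_all add: endo_zero[OF assms(1)] endo_add[OF assms(1)] endo_scale[OF assms(1)]
       fsupp_sum fsupp_scale)

section \<open>Locally finite operator series and their commutators\<close>

definition locally_finite :: "'b set \<Rightarrow> (nat \<Rightarrow> 'b vec \<Rightarrow> 'b vec) \<Rightarrow> bool" where
  "locally_finite B X \<longleftrightarrow> (\<forall>i. endo_on (fsupp B) (X i))
     \<and> (\<forall>v\<in>fsupp B. \<exists>N. \<forall>i>N. X i v = (\<lambda>_. 0))"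

text \<open>The index set varies with \<open>w\<close>, which hides linearity;
  \<open>series_op_eq\<close> replaces it by a common finite range.\<close>

definition series_op :: "(nat \<Rightarrow> complex) \<Rightarrow> (nat \<Rightarrow> 'b vec \<Rightarrow> 'b vec) \<Rightarrow> 'b vec \<Rightarrow> 'b vec" where
  "series_op c X w = (\<lambda>b. \<Sum>i\<in>{i. X i w \<noteq> (\<lambda>_. 0)}. c i * X i w b)"

lemma series_op_eq:
  assumes "\<And>i. i > M \<Longrightarrow> X i w = (\<lambda>_. 0)"
  shows "series_op c X w = (\<lambda>b. \<Sum>i\<le>M. c i * X i w b)"
  unfolding series_op_def
proof (intro ext sum.mono_neutral_left)
  show "{i. X i w \<noteq> (\<lambda>_. 0)} \<subseteq> {..M}" using assms by (auto simp: not_le[symmetric])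
qed auto

lemma locally_finite_endo: "locally_finite B X \<Longrightarrow> endo_on (fsupp B) (X i)"
  by (simp add: locally_finite_def)

lemma locally_finite_bound:
  assumes "locally_finite B X" "finite S" "S \<subseteq> fsupp B"
  shows "\<exists>N. \<forall>v\<in>S. \<forall>i>N. X i v = (\<lambda>_. 0)"
  using assms(2,3)
proof (induction S rule: finite_induct)
  case (insert s S)
  then obtain N where N: "\<forall>v\<in>S. \<forall>i>N. X i v = (\<lambda>_. 0)" by auto
  obtain N' where "\<forall>i>N'. X i s = (\<lambda>_. 0)"
    using assms(1) insert.prems unfolding locally_finite_def by blast
  with N show ?case by (intro exI[of _ "max N N'"]) auto
qed simp

lemma endo_series_op:
  assumes X: "locally_finite B X" shows "endo_on (fsupp B) (series_op c X)"
proof -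
  note E = locally_finite_endo[OF X]
  have "series_op c X f \<in> fsupp B" if f: "f \<in> fsupp B" for f
  proof -
    obtain M where M: "\<forall>v\<in>{f}. \<forall>i>M. X i v = (\<lambda>_. 0)"
      using locally_finite_bound[OF X, of "{f}"] f by auto
    then show ?thesis
      using f by (subst series_op_eq[of M]) (auto intro!: fsupp_sum endo_closed[OF E])
  qed
  moreover have "series_op c X (\<lambda>b. f b + g b) = (\<lambda>b. series_op c X f b + series_op c X g b)"
    if f: "f \<in> fsupp B" and g: "g \<in> fsupp B" for f g
  proof -
    obtain M where M: "\<forall>v\<in>{f, g}. \<forall>i>M. X i v = (\<lambda>_. 0)"
      using locally_finite_bound[OF X, of "{f, g}"] f g by auto
    then have "X i (\<lambda>b. f b + g b) = (\<lambda>_. 0)" if "i > M" for i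
      using endo_add[OF E f g] that by simp
    then show ?thesis
      using M by (simp add: series_op_eq[of M] endo_add[OF E f g] distrib_left sum.distrib)
  qed
  moreover have "series_op c X (\<lambda>b. k * f b) = (\<lambda>b. k * series_op c X f b)"
    if f: "f \<in> fsupp B" for k f
  proof -
    obtain M where M: "\<forall>v\<in>{f}. \<forall>i>M. X i v = (\<lambda>_. 0)"
      using locally_finite_bound[OF X, of "{f}"] f by auto
    then have "X i (\<lambda>b. k * f b) = (\<lambda>_. 0)" if "i > M" for i
      using endo_scale[OF E f] that by simp
    then show ?thesis
      using M by (simp add: series_op_eq[of M] endo_scale[OF E f] sum_distrib_left mult.left_commute)
  qed
  ultimately show ?thesis unfolding endo_on_def by blast
qed

text \<open>A Cauchy product: brackets with equal \<open>i + k\<close> land on the same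
  \<open>Z\<close>, so the identity between series reduces to the convolution \<open>coef\<close>.
  At \<open>i = k = 0\<close> the truncated index \<open>i + k - 1\<close> is meaningless, and
  \<open>\<gamma>0\<close> removes that term.\<close>

lemma comm_series_op:
  assumes X: "locally_finite B X" and Y: "locally_finite B Y" and Z: "locally_finite B Z"
    and w: "w \<in> fsupp B"
    and br: "\<And>i k. comm (X i) (Y k) w = (\<lambda>b. \<gamma> i k * Z (i + k - 1) w b)"
    and \<gamma>0: "\<gamma> 0 0 = 0"
    and coef: "\<And>l. (\<Sum>i\<le>Suc l. a i * e (Suc l - i) * \<gamma> i (Suc l - i)) = K * c l"
  shows "comm (series_op a X) (series_op e Y) w = (\<lambda>b. K * series_op c Z w b)"
proof -
  note EX = locally_finite_endo[OF X] and EY = locally_finite_endo[OF Y]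
  obtain N where N: "\<And>i. i > N \<Longrightarrow> X i w = (\<lambda>_. 0)" "\<And>i. i > N \<Longrightarrow> Y i w = (\<lambda>_. 0)"
      "\<And>i. i > N \<Longrightarrow> Z i w = (\<lambda>_. 0)"
  proof -
    obtain N1 N2 N3 where "\<forall>v\<in>{w}. \<forall>i>N1. X i v = (\<lambda>_. 0)" "\<forall>v\<in>{w}. \<forall>i>N2. Y i v = (\<lambda>_. 0)"
      "\<forall>v\<in>{w}. \<forall>i>N3. Z i v = (\<lambda>_. 0)"
      using locally_finite_bound[OF X, of "{w}"] locally_finite_bound[OF Y, of "{w}"]
        locally_finite_bound[OF Z, of "{w}"] w by auto
    then show ?thesis by (intro that[of "max N1 (max N2 N3)"]) auto
  qed
  obtain N' where N': "\<And>i k. i > N' \<Longrightarrow> k \<le> N \<Longrightarrow> X i (Y k w) = (\<lambda>_. 0)"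
      "\<And>i k. i > N' \<Longrightarrow> k \<le> N \<Longrightarrow> Y i (X k w) = (\<lambda>_. 0)"
  proof -
    obtain N1 N2 where "\<forall>v\<in>(\<lambda>k. Y k w) ` {..N}. \<forall>i>N1. X i v = (\<lambda>_. 0)"
      "\<forall>v\<in>(\<lambda>k. X k w) ` {..N}. \<forall>i>N2. Y i v = (\<lambda>_. 0)"
      using locally_finite_bound[OF X, of "(\<lambda>k. Y k w) ` {..N}"]
        locally_finite_bound[OF Y, of "(\<lambda>k. X k w) ` {..N}"] w endo_closed[OF EX] endo_closed[OF EY]
      by (metis finite_atMost finite_imageI image_subsetI)
    then show ?thesis by (intro that[of "max N1 N2"]) auto
  qed
  \<comment> \<open>Beyond \<open>M\<close> all single and iterated actions on \<open>w\<close>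
    vanish. The \<open>Suc\<close> absorbs the shift in \<open>i + k - 1\<close>: off the triangle
    \<open>i + k \<le> M\<close> this index is at least \<open>M\<close>, where \<open>Z\<close>
    already vanishes.\<close>
  define M where "M = Suc (max N N')"
  have XY: "X i (Y k w) = (\<lambda>_. 0)" "Y i (X k w) = (\<lambda>_. 0)" if "i > M" for i k
    using that N' N endo_zero[OF EX] endo_zero[OF EY] by (cases "k \<le> N"; simp add: M_def)+
  have XM: "X i w = (\<lambda>_. 0)" "Y i w = (\<lambda>_. 0)" if "i > M" for i
    using that N by (simp_all add: M_def)
  have ZM: "Z i w = (\<lambda>_. 0)" if "i \<ge> M" for i
    using that N by (simp add: M_def)
  have XY_sum: "series_op a X (series_op e Y w) = (\<lambda>b. \<Sum>i\<le>M. \<Sum>k\<le>M. a i * e k * X i (Y k w) b)"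
  proof -
    have eY: "series_op e Y w = (\<lambda>b. \<Sum>k\<le>M. e k * Y k w b)"
      by (rule series_op_eq) (rule XM)
    have X_eY: "X i (\<lambda>b. \<Sum>k\<le>M. e k * Y k w b) = (\<lambda>b. \<Sum>k\<le>M. e k * X i (Y k w) b)" for i
      by (intro endo_sum[OF EX] endo_closed[OF EY] w)
    show ?thesis
      unfolding eY by (subst series_op_eq[of M]) (simp_all add: X_eY XY sum_distrib_left mult.assoc)
  qed
  have YX_sum: "series_op e Y (series_op a X w) = (\<lambda>b. \<Sum>i\<le>M. \<Sum>k\<le>M. a i * e k * Y k (X i w) b)"
  proof -
    have aX: "series_op a X w = (\<lambda>b. \<Sum>k\<le>M. a k * X k w b)"
      by (rule series_op_eq) (rule XM)
    have Y_aX: "Y i (\<lambda>b. \<Sum>k\<le>M. a k * X k w b) = (\<lambda>b. \<Sum>k\<le>M. a k * Y i (X k w) b)" for i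
      by (intro endo_sum[OF EY] endo_closed[OF EX] w)
    have "series_op e Y (series_op a X w) = (\<lambda>b. \<Sum>k\<le>M. \<Sum>i\<le>M. a i * e k * Y k (X i w) b)"
      unfolding aX by (subst series_op_eq[of M]) (simp_all add: Y_aX XY sum_distrib_left mult_ac)
    then show ?thesis by (subst sum.swap)
  qed
  have "comm (series_op a X) (series_op e Y) w b = K * series_op c Z w b" for b
  proof -
    have "comm (series_op a X) (series_op e Y) w b
      = (\<Sum>i\<le>M. \<Sum>k\<le>M. a i * e k * comm (X i) (Y k) w b)"
      unfolding comm_def XY_sum YX_sum by (simp add: sum_subtractf right_diff_distrib)
    also have "\<dots> = (\<Sum>(i, k)\<in>{..M} \<times> {..M}. a i * e k * (\<gamma> i k * Z (i + k - 1) w b))"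
      by (simp add: br sum.cartesian_product)
    also have "\<dots> = (\<Sum>(i, k)\<in>{(i, k). i + k \<le> M}. a i * e k * (\<gamma> i k * Z (i + k - 1) w b))"
    proof (rule sum.mono_neutral_right)
      have Z0: "Z (i + k - 1) w b = 0" if "\<not> i + k \<le> M" for i k
        using that by (subst ZM) auto
      show "\<forall>p\<in>{..M} \<times> {..M} - {(i, k). i + k \<le> M}.
          (case p of (i, k) \<Rightarrow> a i * e k * (\<gamma> i k * Z (i + k - 1) w b)) = 0"
      proof (intro ballI)
        fix p assume "p \<in> {..M} \<times> {..M} - {(i, k). i + k \<le> M}"
        then obtain i k where "p = (i, k)" "\<not> i + k \<le> M" by auto
        then show "(case p of (i, k) \<Rightarrow> a i * e k * (\<gamma> i k * Z (i + k - 1) w b)) = 0"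
          by (simp add: Z0 del: One_nat_def)
      qed
    qed auto
    also have "\<dots> = (\<Sum>s\<le>M. \<Sum>i\<le>s. a i * e (s - i) * (\<gamma> i (s - i) * Z (i + (s - i) - 1) w b))"
      by (rule sum.triangle_reindex_eq)
    also have "\<dots> = (\<Sum>s\<le>M. (\<Sum>i\<le>s. a i * e (s - i) * \<gamma> i (s - i)) * Z (s - 1) w b)"
      by (simp add: sum_distrib_right mult.assoc)
    also have "\<dots> = (\<Sum>l\<le>max N N'. K * c l * Z l w b)"
      unfolding M_def sum.atMost_Suc_shift[where n = "max N N'"]
      by (simp add: \<gamma>0 coef del: sum.atMost_Suc)
    also have "\<dots> = K * series_op c Z w b"
    proof -
      have "series_op c Z w = (\<lambda>b. \<Sum>l\<le>max N N'. c l * Z l w b)"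
        by (rule series_op_eq, rule ZM) (simp only: M_def Suc_le_eq)
      then show ?thesis by (simp add: sum_distrib_left mult.assoc)
    qed
    finally show ?thesis .
  qed
  then show ?thesis by blast
qed

text \<open>The coefficient of \<open>t^i\<close> in \<open>(t + l)^m\<close>, where
  \<open>m\<close> may be negative.\<close>

definition binom_coeff :: "complex \<Rightarrow> int \<Rightarrow> nat \<Rightarrow> complex" where
  "binom_coeff l m i = (of_int m gchoose i) * l powi (m - int i)"

text \<open>Comparison of coefficients in \<open>(t+l)^n\<close> times the derivative of
  \<open>(t+l)^m\<close>, which equals \<open>m (t+l)^(n+m-1)\<close>. Absorption supplies the
  factor \<open>m\<close>, and Vandermonde sums the products.\<close>

lemma binom_coeff_convolution:
  assumes "l \<noteq> 0"
  shows "(\<Sum>i\<le>Suc s. binom_coeff l n i * binom_coeff l m (Suc s - i) * of_nat (Suc s - i))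
    = of_int m * binom_coeff l (n + m - 1) s" (is "?L1 = _")
    and "(\<Sum>i\<le>Suc s. binom_coeff l n i * binom_coeff l m (Suc s - i) * of_nat i)
    = of_int n * binom_coeff l (n + m - 1) s"
proof -
  have main: "(\<Sum>i\<le>Suc s. binom_coeff l n i * binom_coeff l m (Suc s - i) * of_nat (Suc s - i))
    = of_int m * binom_coeff l (n + m - 1) s" for n m
  proof -
    have "binom_coeff l n i * binom_coeff l m (Suc s - i) * of_nat (Suc s - i)
      = of_int m * l powi (n + m - 1 - int s) * ((of_int n gchoose i) * (of_int (m - 1) gchoose (s - i)))"
      if "i \<le> s" for i
    proof -
      have absorb: "of_nat (Suc (s - i)) * ((of_int m :: complex) gchoose Suc (s - i))
          = of_int m * (of_int (m - 1) gchoose (s - i))"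
        using gbinomial_absorption[of "s - i" "of_int m :: complex"] by simp
      have pow: "l powi (n - int i) * l powi (m - int (Suc (s - i))) = l powi (n + m - 1 - int s)"
        using assms that by (subst power_int_add[symmetric]) (auto simp: algebra_simps of_nat_diff)
      have "binom_coeff l n i * binom_coeff l m (Suc s - i) * of_nat (Suc s - i)
        = (of_nat (Suc (s - i)) * (of_int m gchoose Suc (s - i)))
          * (l powi (n - int i) * l powi (m - int (Suc (s - i)))) * (of_int n gchoose i)"
        unfolding binom_coeff_def Suc_diff_le[OF that] by (simp only: mult_ac)
      then show ?thesis by (simp only: absorb pow mult_ac)
    qed
    then have "(\<Sum>i\<le>Suc s. binom_coeff l n i * binom_coeff l m (Suc s - i) * of_nat (Suc s - i))
      = of_int m * l powi (n + m - 1 - int s) * (\<Sum>i\<in>{0..s}. (of_int n gchoose i) * (of_int (m - 1) gchoose (s - i)))"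
      by (simp add: sum_distrib_left atLeast0AtMost)
    also have "\<dots> = of_int m * binom_coeff l (n + m - 1) s"
      unfolding gbinomial_Vandermonde by (simp add: binom_coeff_def algebra_simps)
    finally show ?thesis .
  qed
  from main[of n m] show "?L1 = of_int m * binom_coeff l (n + m - 1) s" .
  \<comment> \<open>Reversing the summation exchanges the roles of \<open>n\<close> and
    \<open>m\<close>.\<close>
  have "(\<Sum>i\<le>Suc s. binom_coeff l n i * binom_coeff l m (Suc s - i) * of_nat i)
    = (\<Sum>i\<le>Suc s. binom_coeff l n (Suc s - i) * binom_coeff l m i * of_nat (Suc s - i))"
    by (rule sum.reindex_bij_witness[of _ "\<lambda>i. Suc s - i" "\<lambda>i. Suc s - i"]) auto
  also have "\<dots> = of_int n * binom_coeff l (m + n - 1) s"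
    using main[of m n] by (simp add: mult_ac del: sum.atMost_Suc of_nat_Suc of_nat_diff)
  finally show "(\<Sum>i\<le>Suc s. binom_coeff l n i * binom_coeff l m (Suc s - i) * of_nat i)
    = of_int n * binom_coeff l (n + m - 1) s"
    by (simp add: add.commute)
qed

text \<open>Both shifts by one come from \<open>d_m = t^(m+1) d/dt\<close>: the series is indexed by
  the exponent of \<open>t\<close>, not by the degree.\<close>

lemma shift_d_series: "shift_d l rd m = series_op (binom_coeff l (m + 1)) (\<lambda>i. rd (int i - 1))"
  by (intro ext) (simp add: shift_d_def series_op_def binom_coeff_def)

lemma shift_I_series: "shift_I l rI m = series_op (binom_coeff l m) (\<lambda>i. rI (int i))"
  by (intro ext) (simp add: shift_I_def series_op_def binom_coeff_def)

lemma W_locally_finite: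
  assumes "W_module B rd rI" "in_O_W B rd rI"
  shows "locally_finite B (\<lambda>i. rd (int i - 1))" "locally_finite B (\<lambda>i. rI (int i))"
proof -
  have "\<exists>N. \<forall>i>N. rd (int i - 1) v = (\<lambda>_. 0) \<and> rI (int i) v = (\<lambda>_. 0)" if v: "v \<in> fsupp B" for v
  proof -
    obtain N :: int where "\<forall>k>N. rd k v = (\<lambda>_. 0) \<and> rI k v = (\<lambda>_. 0)"
      using assms(2) v unfolding in_O_W_def by blast
    then show ?thesis by (intro exI[of _ "nat (N + 1)"]) auto
  qed
  then show "locally_finite B (\<lambda>i. rd (int i - 1))" "locally_finite B (\<lambda>i. rI (int i))"
    using assms(1) unfolding locally_finite_def W_module_def by (auto; meson)+
qed

text \<open>Translation by \<open>l\<close> respects products and derivatives of functions, hence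
  the brackets; no central terms occur because the \<open>z_k\<close> act by zero on
  \<open>W[\<lambda>]\<close>. The structure constants in exponent indexing are
  \<open>k - i\<close>, \<open>k\<close> and 0.\<close>

lemma shift_brackets:
  assumes W: "W_module B rd rI" "in_O_W B rd rI" and l: "l \<noteq> 0" and w: "w \<in> fsupp B"
  shows "comm (shift_d l rd n) (shift_d l rd m) w = (\<lambda>b. of_int (m - n) * shift_d l rd (m + n) w b)"
    and "comm (shift_d l rd n) (shift_I l rI m) w = (\<lambda>b. of_int m * shift_I l rI (m + n) w b)"
    and "comm (shift_I l rI n) (shift_I l rI m) w = (\<lambda>_. 0)"
proof -
  note LF = W_locally_finite[OF W]
  have dd: "comm (rd n) (rd m) w = (\<lambda>b. of_int (m - n) * rd (m + n) w b)" if "n \<ge> -1" "m \<ge> -1" for n m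
    using W(1) w that unfolding W_module_def by blast
  have dI: "comm (rd n) (rI m) w = (\<lambda>b. of_int m * rI (m + n) w b)" if "n \<ge> -1" "m \<ge> 0" for n m
    using W(1) w that unfolding W_module_def by blast
  have II: "comm (rI n) (rI m) w = (\<lambda>_. 0)" if "n \<ge> 0" "m \<ge> 0" for n m
    using W(1) w that unfolding W_module_def by blast
  show "comm (shift_d l rd n) (shift_d l rd m) w = (\<lambda>b. of_int (m - n) * shift_d l rd (m + n) w b)"
    unfolding shift_d_series
  proof (rule comm_series_op[OF LF(1) LF(1) LF(1) w])
    \<comment> \<open>Only \<open>i = k = 0\<close> truncates \<open>i + k - 1\<close>, and there
      the structure constant is zero.\<close>
    show "comm (rd (int i - 1)) (rd (int k - 1)) w
      = (\<lambda>b. (of_nat k - of_nat i) * rd (int (i + k - 1) - 1) w b)" for i k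
      by (cases "i + k = 0") (auto simp: dd of_nat_diff algebra_simps)
    show "(\<Sum>i\<le>Suc s. binom_coeff l (n + 1) i * binom_coeff l (m + 1) (Suc s - i)
        * (of_nat (Suc s - i) - of_nat i)) = of_int (m - n) * binom_coeff l (m + n + 1) s" for s
      using binom_coeff_convolution[OF l, where n = "n + 1" and m = "m + 1" and s = s]
      by (simp only: right_diff_distrib sum_subtractf) (simp add: algebra_simps)
  qed simp
  show "comm (shift_d l rd n) (shift_I l rI m) w = (\<lambda>b. of_int m * shift_I l rI (m + n) w b)"
    unfolding shift_d_series shift_I_series
  proof (rule comm_series_op[OF LF(1) LF(2) LF(2) w])
    show "comm (rd (int i - 1)) (rI (int k)) w = (\<lambda>b. of_nat k * rI (int (i + k - 1)) w b)" for i k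
      by (cases "k = 0") (auto simp: dI of_nat_diff algebra_simps)
    show "(\<Sum>i\<le>Suc s. binom_coeff l (n + 1) i * binom_coeff l m (Suc s - i) * of_nat (Suc s - i))
        = of_int m * binom_coeff l (m + n) s" for s
      using binom_coeff_convolution(1)[OF l, where n = "n + 1" and m = m and s = s] by (simp only: algebra_simps) simp
  qed simp
  have "comm (shift_I l rI n) (shift_I l rI m) w = (\<lambda>b. 0 * shift_I l rI m w b)"
    unfolding shift_I_series
    by (rule comm_series_op[OF LF(2) LF(2) LF(2) w, where \<gamma> = "\<lambda>_ _. 0"]) (simp_all add: II)
  then show "comm (shift_I l rI n) (shift_I l rI m) w = (\<lambda>_. 0)" by simp
qed

section \<open>Operators on tensor factors\<close>

text \<open>The operator \<open>1 \<otimes> A \<otimes> 1\<close> in coordinates: \<open>A\<close>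
  acts on the slice of \<open>F\<close> through \<open>p\<close>, the other coordinates being
  frozen. Abstract \<open>get\<close> and \<open>put\<close> allow one theory for \<open>V\<close>
  and for all the \<open>W_j\<close>.\<close>

definition act :: "('p \<Rightarrow> 'c) \<Rightarrow> ('p \<Rightarrow> 'c \<Rightarrow> 'p) \<Rightarrow> ('c vec \<Rightarrow> 'c vec) \<Rightarrow> 'p vec \<Rightarrow> 'p vec" where
  "act get put A F = (\<lambda>p. A (\<lambda>c. F (put p c)) (get p))"

text \<open>A range \<open>S\<close> larger than the support is allowed so that different slices can
  be summed over the same finite set.\<close>

lemma endo_kernel:
  assumes A: "endo_on (fsupp C) A" and v: "v \<in> fsupp C" and S: "finite S" "{c. v c \<noteq> 0} \<subseteq> S"
  shows "A v b = (\<Sum>c\<in>S. v c * A (delta c) b)"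
proof -
  have "(\<lambda>x. \<Sum>c\<in>{c. v c \<noteq> 0}. v c * delta c x) = v"
  proof
    fix x
    have "(\<Sum>c\<in>{c. v c \<noteq> 0}. v c * delta c x) = (\<Sum>c\<in>{c. v c \<noteq> 0}. if c = x then v c else 0)"
      by (intro sum.cong) (auto simp: delta_def)
    then show "(\<Sum>c\<in>{c. v c \<noteq> 0}. v c * delta c x) = v x"
      using fsupp_finite[OF v] by simp
  qed
  moreover have "delta c \<in> fsupp C" if "c \<in> {c. v c \<noteq> 0}" for c
    using that fsupp_outside[OF v] by (auto intro: fsupp_delta)
  ultimately have "A v = (\<lambda>x. \<Sum>c\<in>{c. v c \<noteq> 0}. v c * A (delta c) x)"
    using endo_sum[OF A, of "{c. v c \<noteq> 0}" delta v] by simp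
  then have "A v b = (\<Sum>c\<in>{c. v c \<noteq> 0}. v c * A (delta c) b)" by simp
  also have "\<dots> = (\<Sum>c\<in>S. v c * A (delta c) b)"
    using S by (intro sum.mono_neutral_left) auto
  finally show ?thesis .
qed

lemma endo_vanish:
  assumes A: "endo_on (fsupp C) A" and v: "v \<in> fsupp C" and "\<And>c. v c \<noteq> 0 \<Longrightarrow> A (delta c) = (\<lambda>_. 0)"
  shows "A v = (\<lambda>_. 0)"
  using endo_kernel[OF A v fsupp_finite[OF v] subset_refl] assms(3) by (intro ext) simp

text \<open>A tensor factor is a coordinate \<open>get\<close> of the basis index \<open>p\<close>, with \<open>put p c\<close> replacing that coordinate.\<close>

locale slot =
  fixes get :: "'p \<Rightarrow> 'c" and put :: "'p \<Rightarrow> 'c \<Rightarrow> 'p" and Q :: "'p set" and C :: "'c set"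
  assumes get_put: "get (put p c) = c"
    and put_put: "put (put p c) d = put p d"
    and put_get: "put p (get p) = p"
    and put_memD: "put p c \<in> Q \<Longrightarrow> c \<in> C"
    and put_mem: "p \<in> Q \<Longrightarrow> c \<in> C \<Longrightarrow> put p c \<in> Q"
begin

lemma slice_fsupp:
  assumes F: "F \<in> fsupp Q" shows "(\<lambda>c. F (put p c)) \<in> fsupp C"
proof -
  have "{c. F (put p c) \<noteq> 0} \<subseteq> get ` {q. F q \<noteq> 0}"
    by (force simp: get_put intro: image_eqI[of _ get "put p _"])
  then have "finite {c. F (put p c) \<noteq> 0}"
    using fsupp_finite[OF F] by (blast intro: finite_subset)
  then show ?thesis using fsupp_outside[OF F] put_memD unfolding fsupp_def by blast
qed

lemma slice_support: "F (put p c) \<noteq> 0 \<Longrightarrow> c \<in> get ` {q. F q \<noteq> 0}"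
  by (rule image_eqI[of _ get "put p c"]) (simp_all add: get_put)

lemma act_kernel:
  assumes F: "F \<in> fsupp Q" and A: "endo_on (fsupp C) A"
  shows "act get put A F p = (\<Sum>c\<in>get ` {q. F q \<noteq> 0}. F (put p c) * A (delta c) (get p))"
  unfolding act_def
  using slice_support[of F p] fsupp_finite[OF F]
  by (intro endo_kernel[OF A slice_fsupp[OF F]]) auto

text \<open>Prepares the comparison with \<open>tens_op\<close>: the test
  \<open>put p (get q) = q\<close> selects the \<open>q\<close> that agree with \<open>p\<close> in
  all other coordinates.\<close>

lemma act_expand:
  assumes F: "F \<in> fsupp Q" and A: "endo_on (fsupp C) A"
  shows "act get put A F p =
    (\<Sum>q\<in>{q. F q \<noteq> 0}. F q * (if put p (get q) = q then A (delta (get q)) (get p) else 0))"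
proof -
  let ?S = "{q. F q \<noteq> 0}"
  have "(\<Sum>q\<in>?S. F q * (if put p (get q) = q then A (delta (get q)) (get p) else 0))
    = (\<Sum>q\<in>{q \<in> ?S. put p (get q) = q}. F q * A (delta (get q)) (get p))"
    using fsupp_finite[OF F] by (intro sum.mono_neutral_cong_right) auto
  also have "\<dots> = (\<Sum>c\<in>{c. F (put p c) \<noteq> 0}. F (put p c) * A (delta c) (get p))"
    by (rule sum.reindex_bij_witness[of _ "put p" get]) (auto simp: get_put put_put)
  also have "\<dots> = act get put A F p"
    unfolding act_def
    by (rule endo_kernel[OF A slice_fsupp[OF F] fsupp_finite[OF slice_fsupp[OF F]] subset_refl, symmetric])
  finally show ?thesis by simp
qed

lemma act_nonzero:
  assumes F: "F \<in> fsupp Q" and A: "endo_on (fsupp C) A" and "act get put A F p \<noteq> 0"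
  shows "\<exists>c. F (put p c) \<noteq> 0"
proof (rule ccontr)
  assume "\<nexists>c. F (put p c) \<noteq> 0"
  then have "(\<lambda>c. F (put p c)) = (\<lambda>_. 0)" by auto
  then show False using assms(3) endo_zero[OF A] by (simp add: act_def)
qed

text \<open>Only finitely many coordinate lines meet the support of \<open>F\<close>, and on each of
  them the image of the slice is finitely supported.\<close>

lemma act_fsupp:
  assumes F: "F \<in> fsupp Q" and A: "endo_on (fsupp C) A"
  shows "act get put A F \<in> fsupp Q"
proof -
  let ?sl = "\<lambda>q c. F (put q c)"
  have sub: "{p. act get put A F p \<noteq> 0} \<subseteq> (\<Union>q\<in>{q. F q \<noteq> 0}. put q ` {c. A (?sl q) c \<noteq> 0})"
  proof
    fix p assume p: "p \<in> {p. act get put A F p \<noteq> 0}"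
    then obtain c where c: "F (put p c) \<noteq> 0" using act_nonzero[OF F A] by blast
    have "?sl (put p c) = ?sl p" by (simp add: put_put)
    then have "get p \<in> {d. A (?sl (put p c)) d \<noteq> 0}" using p by (simp add: act_def)
    moreover have "p = put (put p c) (get p)" by (simp add: put_put put_get)
    ultimately show "p \<in> (\<Union>q\<in>{q. F q \<noteq> 0}. put q ` {c. A (?sl q) c \<noteq> 0})" using c by blast
  qed
  have AF: "A (?sl q) \<in> fsupp C" for q
    by (intro endo_closed[OF A] slice_fsupp[OF F])
  have "finite {p. act get put A F p \<noteq> 0}"
    using fsupp_finite[OF F] fsupp_finite[OF AF] by (intro finite_subset[OF sub]) auto
  moreover have "{p. act get put A F p \<noteq> 0} \<subseteq> Q"
    using sub fsupp_outside[OF F] fsupp_outside[OF AF] put_mem by blast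
  ultimately show ?thesis by (simp add: fsupp_def)
qed

lemma endo_act:
  assumes A: "endo_on (fsupp C) A" shows "endo_on (fsupp Q) (act get put A)"
  unfolding endo_on_def
proof (intro conjI ballI allI)
  fix f g :: "'p vec" and c assume f: "f \<in> fsupp Q"
  show "act get put A f \<in> fsupp Q" by (rule act_fsupp[OF f A])
  show "act get put A (\<lambda>b. c * f b) = (\<lambda>b. c * act get put A f b)"
    unfolding act_def by (simp add: endo_scale[OF A slice_fsupp[OF f]])
  assume g: "g \<in> fsupp Q"
  show "act get put A (\<lambda>b. f b + g b) = (\<lambda>b. act get put A f b + act get put A g b)"
    unfolding act_def by (simp add: endo_add[OF A slice_fsupp[OF f] slice_fsupp[OF g]])
qed

lemma act_act: "act get put A (act get put A' F) = act get put (\<lambda>v. A (A' v)) F"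
  unfolding act_def by (simp add: get_put put_put)

lemma comm_act: "comm (act get put A) (act get put A') F = act get put (comm A A') F"
  unfolding comm_def act_act by (simp add: act_def)

lemma act_cong:
  assumes "F \<in> fsupp Q" "\<And>v. v \<in> fsupp C \<Longrightarrow> A v = A' v"
  shows "act get put A F = act get put A' F"
  unfolding act_def using assms slice_fsupp by simp

text \<open>All lines that miss the support give the zero slice. This finiteness is what makes
  density applicable.\<close>

lemma finite_slices:
  assumes F: "F \<in> fsupp Q" shows "finite (range (\<lambda>p c. F (put p c)))"
proof -
  have "range (\<lambda>p c. F (put p c)) \<subseteq> insert (\<lambda>_. 0) ((\<lambda>q c. F (put q c)) ` {q. F q \<noteq> 0})"
  proof
    fix s assume "s \<in> range (\<lambda>p c. F (put p c))"
    then obtain p where s: "s = (\<lambda>c. F (put p c))" by blast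
    show "s \<in> insert (\<lambda>_. 0) ((\<lambda>q c. F (put q c)) ` {q. F q \<noteq> 0})"
    proof (cases "\<exists>c. F (put p c) \<noteq> 0")
      case True
      then obtain c where "F (put p c) \<noteq> 0" by blast
      then have "s \<in> (\<lambda>q c. F (put q c)) ` {q. F q \<noteq> 0}"
        by (intro image_eqI[of _ _ "put p c"]) (simp_all add: s put_put)
      then show ?thesis by blast
    qed (simp add: s)
  qed
  then show ?thesis using fsupp_finite[OF F] by (blast intro: finite_subset)
qed

end

text \<open>\<open>A'\<close> is written as a finite matrix sum, through which \<open>A\<close>
  passes by linearity.\<close>

lemma act_commute:
  assumes "slot get1 put1 Q C1" "slot get2 put2 Q C2"
    and get1: "\<And>p d. get1 (put2 p d) = get1 p" and get2: "\<And>p c. get2 (put1 p c) = get2 p"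
    and put: "\<And>p c d. put1 (put2 p d) c = put2 (put1 p c) d"
    and A: "endo_on (fsupp C1) A" and A': "endo_on (fsupp C2) A'" and F: "F \<in> fsupp Q"
  shows "act get1 put1 A (act get2 put2 A' F) = act get2 put2 A' (act get1 put1 A F)"
proof
  interpret s1: slot get1 put1 Q C1 by fact
  interpret s2: slot get2 put2 Q C2 by fact
  fix p
  \<comment> \<open>This set contains every second coordinate occurring in \<open>F\<close>, so it
    serves before and after \<open>A\<close> is applied.\<close>
  let ?S = "get2 ` {q. F q \<noteq> 0}"
  have "act get1 put1 A (act get2 put2 A' F) p
    = A (\<lambda>c. \<Sum>d\<in>?S. A' (delta d) (get2 p) * F (put1 (put2 p d) c)) (get1 p)"
    unfolding act_def[of get1] s2.act_kernel[OF F A'] by (simp add: get2 put mult.commute)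
  also have "\<dots> = (\<Sum>d\<in>?S. A' (delta d) (get2 p) * A (\<lambda>c. F (put1 (put2 p d) c)) (get1 p))"
    by (subst endo_sum[OF A]) (auto intro: s1.slice_fsupp[OF F])
  also have "\<dots> = (\<Sum>d\<in>?S. act get1 put1 A F (put2 p d) * A' (delta d) (get2 p))"
    by (simp add: act_def get1 mult.commute)
  also have "\<dots> = A' (\<lambda>d. act get1 put1 A F (put2 p d)) (get2 p)"
  proof (rule endo_kernel[OF A', symmetric])
    show "(\<lambda>d. act get1 put1 A F (put2 p d)) \<in> fsupp C2"
      by (rule s2.slice_fsupp[OF s1.act_fsupp[OF F A]])
    show "finite ?S" using fsupp_finite[OF F] by simp
    show "{d. act get1 put1 A F (put2 p d) \<noteq> 0} \<subseteq> ?S"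
    proof
      fix d assume "d \<in> {d. act get1 put1 A F (put2 p d) \<noteq> 0}"
      then obtain c where "F (put1 (put2 p d) c) \<noteq> 0" using s1.act_nonzero[OF F A] by blast
      then show "d \<in> ?S" unfolding put by (rule s2.slice_support)
    qed
  qed
  finally show "act get1 put1 A (act get2 put2 A' F) p = act get2 put2 A' (act get1 put1 A F) p"
    by (simp add: act_def[of get2])
qed

text \<open>The cross terms cancel because operators in different slots commute.\<close>

lemma comm_sum:
  assumes I: "finite I" and E: "\<And>i. i \<in> I \<Longrightarrow> endo_on (fsupp Q) (X i)" "\<And>i. i \<in> I \<Longrightarrow> endo_on (fsupp Q) (Y i)"
    and commute: "\<And>i k. i \<in> I \<Longrightarrow> k \<in> I \<Longrightarrow> i \<noteq> k \<Longrightarrow> X i (Y k F) = Y k (X i F)"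
    and F: "F \<in> fsupp Q"
  shows "(\<Sum>i\<in>I. X i (\<lambda>p. \<Sum>k\<in>I. Y k F p) p) - (\<Sum>k\<in>I. Y k (\<lambda>p. \<Sum>i\<in>I. X i F p) p)
    = (\<Sum>i\<in>I. comm (X i) (Y i) F p)"
proof -
  have "(\<Sum>i\<in>I. X i (\<lambda>p. \<Sum>k\<in>I. Y k F p) p) = (\<Sum>i\<in>I. \<Sum>k\<in>I. X i (Y k F) p)"
    using endo_sum[OF E(1), of _ I "\<lambda>k. Y k F" "\<lambda>_. 1"] endo_closed[OF E(2) F]
    by (intro sum.cong refl) simp
  moreover have "(\<Sum>k\<in>I. Y k (\<lambda>p. \<Sum>i\<in>I. X i F p) p) = (\<Sum>i\<in>I. \<Sum>k\<in>I. Y k (X i F) p)"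
    using endo_sum[OF E(2), of _ I "\<lambda>k. X k F" "\<lambda>_. 1"] endo_closed[OF E(1) F]
    by (subst sum.swap, intro sum.cong refl) simp
  ultimately have "(\<Sum>i\<in>I. X i (\<lambda>p. \<Sum>k\<in>I. Y k F p) p) - (\<Sum>k\<in>I. Y k (\<lambda>p. \<Sum>i\<in>I. X i F p) p)
    = (\<Sum>i\<in>I. \<Sum>k\<in>I. X i (Y k F) p - Y k (X i F) p)"
    by (simp add: sum_subtractf)
  also have "\<dots> = (\<Sum>i\<in>I. \<Sum>k\<in>I. if i = k then comm (X i) (Y i) F p else 0)"
    by (intro sum.cong refl) (auto simp: comm_def commute)
  also have "\<dots> = (\<Sum>i\<in>I. comm (X i) (Y i) F p)" using I by simp
  finally show ?thesis .
qed

section \<open>The tensor product as a space with \<open>n + 1\<close> slots\<close>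

locale tensor_space =
  fixes n :: nat and B0 :: "'a set" and Bs :: "nat \<Rightarrow> 'b set"
begin

definition Q :: "('a \<times> (nat \<Rightarrow> 'b)) set" where "Q = B0 \<times> PiE {1..n} Bs"

abbreviation act0 :: "('a vec \<Rightarrow> 'a vec) \<Rightarrow> ('a \<times> (nat \<Rightarrow> 'b)) vec \<Rightarrow> ('a \<times> (nat \<Rightarrow> 'b)) vec" where
  "act0 \<equiv> act fst (\<lambda>p c. (c, snd p))"

abbreviation actj :: "nat \<Rightarrow> ('b vec \<Rightarrow> 'b vec) \<Rightarrow> ('a \<times> (nat \<Rightarrow> 'b)) vec \<Rightarrow> ('a \<times> (nat \<Rightarrow> 'b)) vec" where
  "actj j \<equiv> act (\<lambda>p. snd p j) (\<lambda>p b. (fst p, (snd p)(j := b)))"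

lemma slot0: "slot fst (\<lambda>p c. (c, snd p)) Q B0"
  by unfold_locales (auto simp: Q_def)

lemma slotj:
  assumes "j \<in> {1..n}" shows "slot (\<lambda>p. snd p j) (\<lambda>p b. (fst p, (snd p)(j := b))) Q (Bs j)"
proof
  show "c \<in> Bs j" if "(fst p, (snd p)(j := c)) \<in> Q" for p c
    using that assms PiE_mem[of "(snd p)(j := c)" "{1..n}" Bs j] by (simp add: Q_def)
  show "(fst p, (snd p)(j := c)) \<in> Q" if "p \<in> Q" "c \<in> Bs j" for p c
    using that assms by (auto simp: Q_def PiE_iff extensional_def)
qed auto

definition factor_ops :: "('a vec \<Rightarrow> 'a vec) \<Rightarrow> (nat \<Rightarrow> 'b vec \<Rightarrow> 'b vec) \<Rightarrow> bool" where
  "factor_ops A B \<longleftrightarrow> endo_on (fsupp B0) A \<and> (\<forall>j\<in>{1..n}. endo_on (fsupp (Bs j)) (B j))"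

text \<open>Slot 0 is \<open>V\<close> and slot \<open>j\<close> is \<open>W_j\<close>, so that
  brackets are computed by a single sum over \<open>{..n}\<close>.\<close>

definition slot_op :: "('a vec \<Rightarrow> 'a vec) \<Rightarrow> (nat \<Rightarrow> 'b vec \<Rightarrow> 'b vec) \<Rightarrow> nat
    \<Rightarrow> ('a \<times> (nat \<Rightarrow> 'b)) vec \<Rightarrow> ('a \<times> (nat \<Rightarrow> 'b)) vec" where
  "slot_op A B i = (if i = 0 then act0 A else actj i (B i))"

text \<open>The two tests in \<open>tens_op\<close> are those of \<open>act_expand\<close> for the
  respective slots. Afterwards the explicit basis formula is not opened again.\<close>

lemma tens_op_act:
  assumes AB: "factor_ops A B" and F: "F \<in> fsupp Q"
  shows "tens_op A B n F = (\<lambda>p. act0 A F p + (\<Sum>j\<in>{1..n}. actj j (B j) F p))"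
proof
  fix p :: "'a \<times> (nat \<Rightarrow> 'b)"
  obtain a g where p: "p = (a, g)" by force
  have E: "endo_on (fsupp B0) A" "\<And>j. j \<in> {1..n} \<Longrightarrow> endo_on (fsupp (Bs j)) (B j)"
    using AB by (auto simp: factor_ops_def)
  have "act0 A F p = (\<Sum>q\<in>{q. F q \<noteq> 0}. F q * (if snd q = g then A (delta (fst q)) a else 0))"
    unfolding slot.act_expand[OF slot0 F E(1)] p
    by (intro sum.cong refl) (auto simp: prod_eq_iff)
  moreover have "actj j (B j) F p = (\<Sum>q\<in>{q. F q \<noteq> 0}. F q *
      (if fst q = a \<and> (\<forall>i. i \<noteq> j \<longrightarrow> snd q i = g i) then B j (delta (snd q j)) (g j) else 0))"
    if "j \<in> {1..n}" for j
  proof -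
    have "(fst p, (snd p)(j := snd q j)) = q \<longleftrightarrow> fst q = a \<and> (\<forall>i. i \<noteq> j \<longrightarrow> snd q i = g i)"
      for q :: "'a \<times> (nat \<Rightarrow> 'b)"
      by (auto simp: p prod_eq_iff fun_eq_iff)
    then show ?thesis
      unfolding slot.act_expand[OF slotj[OF that] F E(2)[OF that]] by (simp add: p cong: if_cong)
  qed
  ultimately show "tens_op A B n F p = act0 A F p + (\<Sum>j\<in>{1..n}. actj j (B j) F p)"
    unfolding tens_op_def p
    by (simp add: distrib_left sum.distrib sum_distrib_left) (rule sum.swap)
qed

lemma tens_op_sum:
  assumes "factor_ops A B" "F \<in> fsupp Q"
  shows "tens_op A B n F = (\<lambda>p. \<Sum>i\<le>n. slot_op A B i F p)"
proof -
  have "{..n} = insert 0 {1..n}" by auto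
  then show ?thesis
    unfolding tens_op_act[OF assms] by (simp add: slot_op_def)
qed

lemma endo_slot_op:
  assumes "factor_ops A B" "i \<le> n" shows "endo_on (fsupp Q) (slot_op A B i)"
  using assms slot.endo_act[OF slot0] slot.endo_act[OF slotj, of i]
  by (auto simp: slot_op_def factor_ops_def)

lemma slot_op_commute:
  assumes AB: "factor_ops A B" "factor_ops A' B'" and F: "F \<in> fsupp Q"
    and ik: "i \<le> n" "k \<le> n" "i \<noteq> k"
  shows "slot_op A B i (slot_op A' B' k F) = slot_op A' B' k (slot_op A B i F)"
proof (cases "i = 0 \<or> k = 0")
  case True
  then show ?thesis
  proof
    assume "i = 0"
    moreover then have k: "k \<in> {1..n}" using ik by auto
    ultimately show ?thesis
      using act_commute[OF slot0 slotj[OF k], of A "B' k" F] AB F k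
      by (simp add: slot_op_def factor_ops_def)
  next
    assume "k = 0"
    moreover then have i: "i \<in> {1..n}" using ik by auto
    ultimately show ?thesis
      using act_commute[OF slot0 slotj[OF i], of A' "B i" F] AB F i
      by (simp add: slot_op_def factor_ops_def)
  qed
next
  case False
  then have i: "i \<in> {1..n}" and k: "k \<in> {1..n}" using ik by auto
  then show ?thesis
    using act_commute[OF slotj[OF i] slotj[OF k], of "B i" "B' k" F] AB F ik False
    by (simp add: slot_op_def factor_ops_def fun_upd_twist)
qed

lemma endo_tens_op:
  assumes "factor_ops A B" shows "endo_on (fsupp Q) (tens_op A B n)"
  unfolding endo_on_def
proof (intro conjI ballI allI)
  note E = endo_slot_op[OF assms]
  fix f g :: "('a \<times> (nat \<Rightarrow> 'b)) vec" and c assume f: "f \<in> fsupp Q"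
  show "tens_op A B n f \<in> fsupp Q"
    using fsupp_sum[of "{..n}" "\<lambda>i. slot_op A B i f" Q "\<lambda>_. 1"] endo_closed[OF E f]
    by (simp add: tens_op_sum[OF assms f])
  show "tens_op A B n (\<lambda>b. c * f b) = (\<lambda>b. c * tens_op A B n f b)"
    by (simp add: tens_op_sum[OF assms] f fsupp_scale endo_scale[OF E f] sum_distrib_left)
  assume g: "g \<in> fsupp Q"
  show "tens_op A B n (\<lambda>b. f b + g b) = (\<lambda>b. tens_op A B n f b + tens_op A B n g b)"
    by (simp add: tens_op_sum[OF assms] f g fsupp_add endo_add[OF E f g] sum.distrib)
qed

text \<open>Brackets are taken slot by slot. The pair \<open>e\<close>, \<open>Z\<close> carries the
  cocycle, which lives on \<open>V\<close> alone, whereas \<open>c\<close> must be the same scalar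
  in all slots.\<close>

lemma comm_tens_op:
  assumes AB: "factor_ops A B" "factor_ops A' B'" "factor_ops A'' B''" "factor_ops Z (\<lambda>j w. (\<lambda>_. 0))"
    and V: "\<And>v. v \<in> fsupp B0 \<Longrightarrow> comm A A' v = (\<lambda>b. c * A'' v b + e * Z v b)"
    and W: "\<And>j w. j \<in> {1..n} \<Longrightarrow> w \<in> fsupp (Bs j) \<Longrightarrow> comm (B j) (B' j) w = (\<lambda>b. c * B'' j w b)"
    and F: "F \<in> fsupp Q"
  shows "comm (tens_op A B n) (tens_op A' B' n) F
    = (\<lambda>p. c * tens_op A'' B'' n F p + e * tens_op Z (\<lambda>j w. (\<lambda>_. 0)) n F p)"
proof
  fix p
  note E = endo_slot_op[OF AB(1)] and E' = endo_slot_op[OF AB(2)]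
  have X: "tens_op A B n F = (\<lambda>p. \<Sum>i\<le>n. slot_op A B i F p)"
    "tens_op A' B' n F = (\<lambda>p. \<Sum>i\<le>n. slot_op A' B' i F p)"
    using tens_op_sum[OF AB(1) F] tens_op_sum[OF AB(2) F] .
  have "tens_op A' B' n F \<in> fsupp Q" "tens_op A B n F \<in> fsupp Q"
    using endo_closed[OF endo_tens_op[OF AB(2)] F] endo_closed[OF endo_tens_op[OF AB(1)] F] .
  then have "comm (tens_op A B n) (tens_op A' B' n) F p
    = (\<Sum>i\<le>n. slot_op A B i (\<lambda>p. \<Sum>k\<le>n. slot_op A' B' k F p) p)
      - (\<Sum>k\<le>n. slot_op A' B' k (\<lambda>p. \<Sum>i\<le>n. slot_op A B i F p) p)"
    unfolding comm_def by (simp only: tens_op_sum[OF AB(1)] tens_op_sum[OF AB(2)] X)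
  also have "\<dots> = (\<Sum>i\<le>n. comm (slot_op A B i) (slot_op A' B' i) F p)"
    using slot_op_commute[OF AB(1,2) F] by (intro comm_sum[OF _ E E' _ F]) auto
  also have "\<dots> = (\<Sum>i\<le>n. c * slot_op A'' B'' i F p + e * slot_op Z (\<lambda>j w. (\<lambda>_. 0)) i F p)"
  proof (intro sum.cong refl)
    fix i assume "i \<in> {..n}"
    show "comm (slot_op A B i) (slot_op A' B' i) F p
      = c * slot_op A'' B'' i F p + e * slot_op Z (\<lambda>j w. (\<lambda>_. 0)) i F p"
    proof (cases "i = 0")
      case True
      have "comm (act0 A) (act0 A') F = act0 (\<lambda>v b. c * A'' v b + e * Z v b) F"
        unfolding slot.comm_act[OF slot0] by (rule slot.act_cong[OF slot0 F V])
      then show ?thesis using True by (simp add: slot_op_def) (simp add: act_def)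
    next
      case False
      then have i: "i \<in> {1..n}" using \<open>i \<in> {..n}\<close> by auto
      have "comm (actj i (B i)) (actj i (B' i)) F = actj i (\<lambda>w b. c * B'' i w b) F"
        unfolding slot.comm_act[OF slotj[OF i]] by (rule slot.act_cong[OF slotj[OF i] F W[OF i]])
      then show ?thesis using False by (simp add: slot_op_def) (simp add: act_def)
    qed
  qed
  also have "\<dots> = c * tens_op A'' B'' n F p + e * tens_op Z (\<lambda>j w. (\<lambda>_. 0)) n F p"
    by (simp add: tens_op_sum[OF AB(3) F] tens_op_sum[OF AB(4) F] sum.distrib sum_distrib_left)
  finally show "comm (tens_op A B n) (tens_op A' B' n) F p
    = c * tens_op A'' B'' n F p + e * tens_op Z (\<lambda>j w. (\<lambda>_. 0)) n F p" .
qed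

end

section \<open>Submodules of the tensor product\<close>

interpretation fun_vs: complex_vector_space "\<lambda>c (f :: 'p \<Rightarrow> complex) p. c * f p"
  by unfold_locales (auto simp: fun_eq_iff algebra_simps)

lemma sum_fun_eq: "(\<Sum>i\<in>I. f i) = (\<lambda>p. \<Sum>i\<in>I. f i p)" for f :: "'i \<Rightarrow> 'p \<Rightarrow> complex"
  by (induction I rule: infinite_finite_induct) (auto simp: fun_eq_iff)

lemma subspace_fun_iff:
  "fun_vs.subspace U \<longleftrightarrow> (\<lambda>_. 0) \<in> U \<and> (\<forall>f\<in>U. \<forall>g\<in>U. (\<lambda>b. f b + g b) \<in> U)
    \<and> (\<forall>c. \<forall>f\<in>U. (\<lambda>b. c * f b) \<in> U)"
  by (simp add: fun_vs.subspace_def plus_fun_def zero_fun_def)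

lemma subspace_fun_sum:
  assumes "fun_vs.subspace U" "\<And>i. i \<in> I \<Longrightarrow> f i \<in> U"
  shows "(\<lambda>p. \<Sum>i\<in>I. c i * f i p) \<in> U"
  using fun_vs.subspace_sum[OF assms(1), of I "\<lambda>i p. c i * f i p"] assms
  by (simp add: sum_fun_eq subspace_fun_iff)

text \<open>Indexing \<open>d_(-1), d_0, ...\<close> and \<open>I_0, I_1, ...\<close> by naturals
  makes the family visibly countable, and stability under it is exactly the closure condition of a
  submodule.\<close>

lemma simple_W_operator_module:
  assumes "simple_W B rd rI"
  shows "simple_operator_module (\<lambda>c (f :: 'b vec) b. c * f b) (fsupp B)
    (range (\<lambda>i. rd (int i - 1)) \<union> range (\<lambda>i. rI (int i)))" (is "simple_operator_module _ _ ?G")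
proof
  have E: "endo_on (fsupp B) g" if "g \<in> ?G" for g
    using that assms unfolding simple_W_def W_module_def by auto
  show "fun_vs.subspace (fsupp B)"
    by (auto simp: subspace_fun_iff intro: fsupp_zero fsupp_add fsupp_scale)
  obtain b where "b \<in> B" using assms unfolding simple_W_def by blast
  then show "\<exists>v\<in>fsupp B. v \<noteq> 0"
    by (intro bexI[of _ "delta b"] fsupp_delta) (auto simp: delta_def fun_eq_iff)
  show "countable ?G" by auto
  show "g x \<in> fsupp B" if "g \<in> ?G" "x \<in> fsupp B" for g x
    using that endo_closed[OF E] by blast
  show "g (x + y) = g x + g y" if "g \<in> ?G" "x \<in> fsupp B" "y \<in> fsupp B" for g x y
    using endo_add[OF E[OF that(1)] that(2,3)] by (simp add: plus_fun_def)
  show "g (\<lambda>b. c * x b) = (\<lambda>b. c * g x b)" if "g \<in> ?G" "x \<in> fsupp B" for g c x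
    using endo_scale[OF E[OF that(1)] that(2)] .
  show "U = {0} \<or> U = fsupp B"
    if U: "fun_vs.subspace U" "U \<subseteq> fsupp B" and closed: "\<And>g x. g \<in> ?G \<Longrightarrow> x \<in> U \<Longrightarrow> g x \<in> U" for U
  proof -
    have "rd m u \<in> U" if "m \<ge> -1" "u \<in> U" for m u
    proof -
      have "rd m = rd (int (nat (m + 1)) - 1)" using that by simp
      then show ?thesis using closed that by blast
    qed
    moreover have "rI m u \<in> U" if "m \<ge> 0" "u \<in> U" for m u
    proof -
      have "rI m = rI (int (nat m))" using that by simp
      then show ?thesis using closed that by blast
    qed
    ultimately have "W_submodule B rd rI U"
      using U unfolding W_submodule_def subspace_fun_iff by blast
    then show ?thesis using assms unfolding simple_W_def by (simp add: zero_fun_def)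
  qed
qed

text \<open>Brings the coefficients into the shape used in \<open>jet_separation\<close>; for
  \<open>m < i\<close> the truncated \<open>m - i\<close> is harmless since both binomials
  vanish.\<close>

lemma binom_coeff_nat: "binom_coeff l (int m) i = of_nat (m choose i) * l ^ (m - i)"
proof (cases "i \<le> m")
  case True
  then have "int m - int i = int (m - i)" by simp
  then show ?thesis
    unfolding binom_coeff_def by (simp only: power_int_of_nat of_int_of_nat_eq binomial_gbinomial)
next
  case False
  then show ?thesis
    using binomial_gbinomial[of m i, where ?'a = complex] by (simp add: binom_coeff_def binomial_eq_0)
qed

context slot
begin

lemma slice_vanish:
  assumes F: "F \<in> fsupp Q" and A: "endo_on (fsupp C) A"
    and "\<And>q. F q \<noteq> 0 \<Longrightarrow> A (delta (get q)) = (\<lambda>_. 0)"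
  shows "A (\<lambda>c. F (put p c)) = (\<lambda>_. 0)"
  using assms(3) get_put by (intro endo_vanish[OF A slice_fsupp[OF F]]) metis

text \<open>The bound \<open>M\<close> is tested on the basis vectors occurring in \<open>F\<close>,
  so all slices are truncated at the same index.\<close>

lemma act_series_op:
  assumes F: "F \<in> fsupp Q" and X: "locally_finite C X"
    and M: "\<And>i q. i > M \<Longrightarrow> F q \<noteq> 0 \<Longrightarrow> X i (delta (get q)) = (\<lambda>_. 0)"
  shows "act get put (series_op c X) F = (\<lambda>p. \<Sum>i\<le>M. c i * act get put (X i) F p)"
proof -
  have vanish: "X i (\<lambda>c. F (put p c)) = (\<lambda>_. 0)" if "i > M" for i p
    using that M by (intro slice_vanish[OF F locally_finite_endo[OF X]])
  have "series_op c X (\<lambda>c. F (put p c)) = (\<lambda>b. \<Sum>i\<le>M. c i * X i (\<lambda>c. F (put p c)) b)" for p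
    by (rule series_op_eq, rule vanish)
  then show ?thesis by (simp add: act_def)
qed

lemma finite_deltas:
  assumes F: "F \<in> fsupp Q"
  shows "finite ((\<lambda>q. delta (get q)) ` {q. F q \<noteq> 0})" "(\<lambda>q. delta (get q)) ` {q. F q \<noteq> 0} \<subseteq> fsupp C"
proof -
  show "finite ((\<lambda>q. delta (get q)) ` {q. F q \<noteq> 0})" using fsupp_finite[OF F] by simp
  have "get q \<in> C" if "F q \<noteq> 0" for q
    using that fsupp_outside[OF F, of q] put_memD[of q "get q"] by (auto simp: put_get)
  then show "(\<lambda>q. delta (get q)) ` {q. F q \<noteq> 0} \<subseteq> fsupp C" by (auto intro: fsupp_delta)
qed

text \<open>By density, a matrix unit acts on the finitely many slices of \<open>u\<close> like some element of the algebra generated by \<open>G\<close>.\<close>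

lemma matrix_unit_closed:
  assumes G: "simple_operator_module (\<lambda>c (f :: 'c vec) b. c * f b) (fsupp C) G"
    and U: "fun_vs.subspace U" "U \<subseteq> fsupp Q" and closed: "\<And>g u. g \<in> G \<Longrightarrow> u \<in> U \<Longrightarrow> act get put g u \<in> U"
    and b: "b \<in> C" and u: "u \<in> U"
  shows "act get put (\<lambda>w x. w c * delta b x) u \<in> U"
proof -
  interpret M: simple_operator_module "\<lambda>c (f :: 'c vec) b. c * f b" "fsupp C" G by (rule G)
  \<comment> \<open>Each product in \<open>alg\<close> adds a single generator on the left, so
    closure under \<open>G\<close> is enough.\<close>
  have alg: "act get put a v \<in> U" if "a \<in> M.alg" "v \<in> U" for a v
    using that
  proof (induction arbitrary: v rule: M.alg.induct)
    case alg_id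
    then show ?case by (simp add: act_def put_get)
  next
    case (alg_G g a)
    then show ?case using closed by (simp flip: act_act)
  next
    case (alg_add a b)
    then have "(\<lambda>p. act get put a v p + act get put b v p) \<in> U"
      using U(1) unfolding subspace_fun_iff by blast
    then show ?case by (simp add: act_def)
  next
    case (alg_scale a c)
    then have "(\<lambda>p. c * act get put a v p) \<in> U"
      using U(1) unfolding subspace_fun_iff by blast
    then show ?case by (simp add: act_def)
  qed
  have uQ: "u \<in> fsupp Q" using U u by blast
  \<comment> \<open>The map is the matrix unit that sends coordinate \<open>c\<close> to coordinate
    \<open>b\<close>.\<close>
  have "M.lin_on_W (\<lambda>w x. w c * delta b x)"
    unfolding M.lin_on_W_def
  proof (intro conjI ballI allI)
    show "(\<lambda>x. w c * delta b x) \<in> fsupp C" for w by (rule fsupp_scale[OF fsupp_delta[OF b]])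
    show "(\<lambda>x. (v + w) c * delta b x) = (\<lambda>x. v c * delta b x) + (\<lambda>x. w c * delta b x)" for v w
      by (intro ext) (simp add: distrib_right)
    show "(\<lambda>x. k * w c * delta b x) = (\<lambda>x. k * (w c * delta b x))" for k w
      by (intro ext) (rule mult.assoc)
  qed
  moreover have "range (\<lambda>p c. u (put p c)) \<subseteq> fsupp C" using slice_fsupp[OF uQ] by blast
  ultimately obtain a where a: "a \<in> M.alg"
    "\<forall>w\<in>range (\<lambda>p c. u (put p c)). a w = (\<lambda>x. w c * delta b x)"
    using M.density[OF _ finite_slices[OF uQ]] by blast
  have "act get put (\<lambda>w x. w c * delta b x) u = act get put a u"
    using a(2) by (simp add: act_def)
  with alg[OF a(1) u] show ?thesis by simp
qed

end

section \<open>Separating the tensor factors\<close>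

context tensor_space
begin

text \<open>For large exponents \<open>V\<close> contributes nothing on \<open>u\<close>, and only
  truncated Taylor expansions in the slots \<open>W_j\<close> remain, which jet separation takes
  apart.\<close>

lemma act_mem_of_tens_op_mem:
  assumes U: "fun_vs.subspace U" and u: "u \<in> fsupp Q"
    and A: "\<And>m::int. endo_on (fsupp B0) (A m)"
    and A0: "\<And>v. v \<in> fsupp B0 \<Longrightarrow> \<exists>N::int. \<forall>k>N. A k v = (\<lambda>_. 0)"
    and X: "\<And>j. j \<in> {1..n} \<Longrightarrow> locally_finite (Bs j) (X j)"
    and lam: "\<And>j. j \<in> {1..n} \<Longrightarrow> lam j \<noteq> 0" "inj_on lam {1..n}"
    and mem: "\<And>m. tens_op (A m) (\<lambda>j. series_op (binom_coeff (lam j) m) (X j)) n u \<in> U"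
  shows "\<And>j i. j \<in> {1..n} \<Longrightarrow> actj j (X j i) u \<in> U" and "act0 (A m) u \<in> U"
proof -
  have fo: "factor_ops (A m) (\<lambda>j. series_op (binom_coeff (lam j) m) (X j))" for m
    using A X by (simp add: factor_ops_def endo_series_op)
  obtain f where f: "\<forall>j\<in>{1..n}. \<forall>v\<in>(\<lambda>q. delta (snd q j)) ` {q. u q \<noteq> 0}. \<forall>i>f j. X j i v = (\<lambda>_. 0)"
    using locally_finite_bound[OF X slot.finite_deltas[OF slotj u]] by metis
  have series: "actj j (series_op c (X j)) u = (\<lambda>p. \<Sum>i\<le>M. c i * actj j (X j i) u p)"
    if j: "j \<in> {1..n}" and M: "(\<Sum>j\<in>{1..n}. f j) \<le> M" for j c M
  proof -
    have "f j \<le> M" using M member_le_sum[of j "{1..n}" f] j by simp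
    then show ?thesis
      using f j by (intro slot.act_series_op[OF slotj[OF j] u X[OF j]]) auto
  qed
  have "locally_finite B0 (\<lambda>i. A (int i))"
    unfolding locally_finite_def
  proof (intro conjI allI ballI A)
    fix v assume "v \<in> fsupp B0"
    then obtain N where "\<forall>k>N. A k v = (\<lambda>_. 0)" using A0 by blast
    then show "\<exists>N. \<forall>i>N. A (int i) v = (\<lambda>_. 0)" by (intro exI[of _ "nat N"]) auto
  qed
  then obtain N where N: "\<forall>v\<in>(\<lambda>q. delta (fst q)) ` {q. u q \<noteq> 0}. \<forall>i>N. A (int i) v = (\<lambda>_. 0)"
    using locally_finite_bound[OF _ slot.finite_deltas[OF slot0 u]] by blast
  have A_vanish: "act0 (A (int m)) u = (\<lambda>_. 0)" if "m > N" for m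
    using slot.slice_vanish[OF slot0 u A, of "int m"] N that by (simp add: act_def)
  \<comment> \<open>The bound contains the sum of all \<open>f j\<close>, to dominate every series,
    and \<open>i\<close>, so that the requested index lies in range.\<close>
  show fac: "actj j (X j i) u \<in> U" if j: "j \<in> {1..n}" for j i
  proof (rule fun_vs.jet_separation[OF U _ lam(2), where ?M0.0 = "Suc N" and M = "i + (\<Sum>j\<in>{1..n}. f j)"
        and v = "\<lambda>j i. actj j (X j i) u"])
    fix m assume m: "Suc N \<le> m"
    let ?M = "i + (\<Sum>j\<in>{1..n}. f j)"
    have "tens_op (A (int m)) (\<lambda>j. series_op (binom_coeff (lam j) (int m)) (X j)) n u
      = (\<lambda>p. \<Sum>j\<in>{1..n}. \<Sum>i\<le>?M. binom_coeff (lam j) (int m) i * actj j (X j i) u p)"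
      using m by (simp add: tens_op_act[OF fo u] A_vanish series[of _ ?M])
    then show "(\<Sum>j\<in>{1..n}. \<Sum>i\<le>?M. (\<lambda>p. (of_nat (m choose i) * lam j ^ (m - i)) * actj j (X j i) u p)) \<in> U"
      using mem[of "int m"] by (simp add: sum_fun_eq binom_coeff_nat)
  qed (use j lam in auto)
  \<comment> \<open>Here \<open>m\<close> is arbitrary, possibly negative: subtracting the known
    contributions of the \<open>W_j\<close> leaves the action on \<open>V\<close>.\<close>
  let ?R = "\<lambda>j. actj j (series_op (binom_coeff (lam j) m) (X j)) u"
  have "?R j \<in> U" if j: "j \<in> {1..n}" for j
    unfolding series[OF j order_refl] by (rule subspace_fun_sum[OF U fac[OF j]])
  then have "(\<lambda>p. \<Sum>j\<in>{1..n}. 1 * ?R j p) \<in> U" by (rule subspace_fun_sum[OF U])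
  then have "tens_op (A m) (\<lambda>j. series_op (binom_coeff (lam j) m) (X j)) n u - (\<lambda>p. \<Sum>j\<in>{1..n}. 1 * ?R j p) \<in> U"
    by (rule fun_vs.subspace_diff[OF U mem])
  then show "act0 (A m) u \<in> U"
    unfolding tens_op_act[OF fo u] by (simp add: fun_diff_def)
qed

text \<open>One matrix unit per slot, sending \<open>g j\<close> to \<open>h j\<close>, extracts the
  component of \<open>u\<close> along \<open>g\<close> and places it at \<open>h\<close>.\<close>

lemma pure_tensor_mem:
  assumes units: "\<And>j b c u. j \<in> {1..n} \<Longrightarrow> b \<in> Bs j \<Longrightarrow> u \<in> U \<Longrightarrow> actj j (\<lambda>w x. w c * delta b x) u \<in> U"
    and u: "u \<in> U" "u \<in> fsupp Q" and g: "g \<in> PiE {1..n} Bs" and h: "h \<in> PiE {1..n} Bs"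
  shows "(\<lambda>(a, q). if q = h then u (a, g) else 0) \<in> U"
proof -
  \<comment> \<open>The state after \<open>k\<close> slots: the first \<open>k\<close> coordinates
    are read off at \<open>g\<close> and forced to be \<open>h\<close>, the others are
    untouched.\<close>
  have "(\<lambda>(a, q). if \<forall>j\<in>{1..k}. q j = h j then u (a, \<lambda>i. if i \<in> {1..k} then g i else q i) else 0) \<in> U"
    (is "?u k \<in> U") if "k \<le> n" for k
    using that
  proof (induction k)
    case 0
    then show ?case using u by simp
  next
    case (Suc k)
    then have "Suc k \<in> {1..n}" "?u k \<in> U" by auto
    moreover from this have "h (Suc k) \<in> Bs (Suc k)" using h by blast
    ultimately have "actj (Suc k) (\<lambda>w x. w (g (Suc k)) * delta (h (Suc k)) x) (?u k) \<in> U"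
      by (intro units)
    moreover have "actj (Suc k) (\<lambda>w x. w (g (Suc k)) * delta (h (Suc k)) x) (?u k) = ?u (Suc k)"
    proof
      fix p :: "'a \<times> (nat \<Rightarrow> 'b)"
      obtain a q where p: "p = (a, q)" by force
      have "(\<lambda>i. if i \<in> {1..k} then g i else (q(Suc k := g (Suc k))) i)
        = (\<lambda>i. if i \<in> {1..Suc k} then g i else q i)"
        by (auto simp: fun_eq_iff le_Suc_eq)
      moreover have "(\<forall>j\<in>{1..k}. (q(Suc k := g (Suc k))) j = h j) \<longleftrightarrow> (\<forall>j\<in>{1..k}. q j = h j)"
        by auto
      moreover have "(\<forall>j\<in>{1..Suc k}. q j = h j) \<longleftrightarrow> (\<forall>j\<in>{1..k}. q j = h j) \<and> q (Suc k) = h (Suc k)"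
        using atLeastAtMostSuc_conv[of 1 k] by auto
      ultimately show "actj (Suc k) (\<lambda>w x. w (g (Suc k)) * delta (h (Suc k)) x) (?u k) p = ?u (Suc k) p"
        unfolding act_def p delta_def by (simp only: prod.case fst_conv snd_conv) simp
    qed
    ultimately show ?case by simp
  qed
  from this[of n] have "?u n \<in> U" by simp
  moreover have "?u n = (\<lambda>(a, q). if q = h then u (a, g) else 0)"
  proof
    fix p :: "'a \<times> (nat \<Rightarrow> 'b)"
    obtain a q where p: "p = (a, q)" by force
    \<comment> \<open>The test covers only \<open>1..n\<close>, while \<open>q = h\<close> compares
      all arguments. Where \<open>q\<close> is not extensional both sides are zero, because
      \<open>u\<close> vanishes off \<open>Q\<close>.\<close>
    show "?u n p = (case p of (a, q) \<Rightarrow> if q = h then u (a, g) else 0)"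
    proof (cases "q \<in> extensional {1..n}")
      case True
      then have "(\<forall>j\<in>{1..n}. q j = h j) \<longleftrightarrow> q = h"
        using h by (auto simp: PiE_iff intro: extensionalityI)
      moreover have "(\<lambda>i. if i \<in> {1..n} then g i else q i) = g"
        using True g by (auto simp: fun_eq_iff PiE_iff extensional_def)
      ultimately show ?thesis unfolding p by simp
    next
      case False
      then obtain i where i: "i \<notin> {1..n}" "q i \<noteq> undefined" by (auto simp: extensional_def)
      then have "(a, \<lambda>i. if i \<in> {1..n} then g i else q i) \<notin> Q"
        by (auto simp: Q_def PiE_iff extensional_def)
      then have "u (a, \<lambda>i. if i \<in> {1..n} then g i else q i) = 0"
        by (rule fsupp_outside[OF u(2)])
      moreover have "q \<noteq> h" using False h by (auto simp: PiE_iff)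
      ultimately show ?thesis unfolding p by simp
    qed
  qed
  ultimately show ?thesis by simp
qed

end

section \<open>Module structure and simplicity of the tensor product\<close>

theorem theorem34:
  fixes n :: nat
    and B0 :: "'a set" and Vd VI :: "int \<Rightarrow> 'a vec \<Rightarrow> 'a vec" and Vz :: "nat \<Rightarrow> 'a vec \<Rightarrow> 'a vec"
    and Bs :: "nat \<Rightarrow> 'b set" and Wd WI :: "nat \<Rightarrow> int \<Rightarrow> 'b vec \<Rightarrow> 'b vec"
    and lam :: "nat \<Rightarrow> complex"
  assumes W: "\<forall>i\<in>{1..n}. simple_W (Bs i) (Wd i) (WI i) \<and> nontrivial_W (Bs i) (Wd i) (WI i)
                \<and> in_O_W (Bs i) (Wd i) (WI i)"
    and V: "simple_L B0 Vd VI Vz" "in_O_L B0 Vd VI"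
    and lam: "\<forall>i\<in>{1..n}. lam i \<noteq> 0" "inj_on lam {1..n}"
  shows "simple_L (B0 \<times> PiE {1..n} Bs)
           (\<lambda>m. tens_op (Vd m) (\<lambda>j. shift_d (lam j) (Wd j) m) n)
           (\<lambda>m. tens_op (VI m) (\<lambda>j. shift_I (lam j) (WI j) m) n)
           (\<lambda>k. tens_op (Vz k) (\<lambda>j w. (\<lambda>_. 0)) n)"
proof -
  interpret tensor_space n B0 Bs .
  let ?d = "\<lambda>m. tens_op (Vd m) (\<lambda>j. shift_d (lam j) (Wd j) m) n"
  let ?I = "\<lambda>m. tens_op (VI m) (\<lambda>j. shift_I (lam j) (WI j) m) n"
  let ?z = "\<lambda>k. tens_op (Vz k) (\<lambda>j w. (\<lambda>_. 0)) n"
  have Wmod: "W_module (Bs j) (Wd j) (WI j)" "in_O_W (Bs j) (Wd j) (WI j)" "simple_W (Bs j) (Wd j) (WI j)"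
    if "j \<in> {1..n}" for j
    using W that unfolding simple_W_def by blast+
  have Vmod: "L_module B0 Vd VI Vz" using V unfolding simple_L_def by blast
  note LF = W_locally_finite[OF Wmod(1,2)]
  have fd: "factor_ops (Vd m) (\<lambda>j. shift_d (lam j) (Wd j) m)" for m
    using Vmod LF unfolding factor_ops_def L_module_def shift_d_series by (auto intro: endo_series_op)
  have fI: "factor_ops (VI m) (\<lambda>j. shift_I (lam j) (WI j) m)" for m
    using Vmod LF unfolding factor_ops_def L_module_def shift_I_series by (auto intro: endo_series_op)
  have fz: "factor_ops (Vz k) (\<lambda>j w. (\<lambda>_. 0))" if "k \<in> {1, 2, 3}" for k
    using Vmod that unfolding factor_ops_def L_module_def by (auto simp: endo_on_def fsupp_zero)
  have fz': "factor_ops (Vz 1) (\<lambda>j w. (\<lambda>_. 0))" "factor_ops (Vz 2) (\<lambda>j w. (\<lambda>_. 0))"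
    "factor_ops (Vz 3) (\<lambda>j w. (\<lambda>_. 0))"
    by (rule fz; simp)+
  have comm_zero: "comm (\<lambda>w. \<lambda>_. 0) S w = (\<lambda>_. 0)" if "S (\<lambda>_. 0) = (\<lambda>_. 0)"
    for S :: "'b vec \<Rightarrow> 'b vec" and w
    using that by (simp add: comm_def)
  have module: "L_module Q ?d ?I ?z"
    unfolding L_module_def
  proof (intro conjI ballI allI)
    show "endo_on (fsupp Q) (?d m)" "endo_on (fsupp Q) (?I m)" for m
      by (rule endo_tens_op[OF fd], rule endo_tens_op[OF fI])
    show "endo_on (fsupp Q) (?z k)" if "k \<in> {1, 2, 3}" for k by (rule endo_tens_op[OF fz[OF that]])
    fix v l m assume v: "v \<in> fsupp Q"
    \<comment> \<open>The Kronecker delta is moved into the scalar \<open>e\<close> to fit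
      \<open>comm_tens_op\<close>, then moved back.\<close>
    have "comm (?d l) (?d m) v = (\<lambda>b. of_int (m - l) * ?d (m + l) v b
      + (if l = - m then of_int (l^3 - l) / 12 else 0) * ?z 1 v b)"
    proof (rule comm_tens_op[OF fd fd fd fz'(1) _ _ v])
      show "comm (Vd l) (Vd m) v = (\<lambda>b. of_int (m - l) * Vd (m + l) v b
        + (if l = - m then of_int (l^3 - l) / 12 else 0) * Vz 1 v b)" if "v \<in> fsupp B0" for v
        using Vmod that unfolding L_module_def by (auto simp: fun_eq_iff)
    qed (use shift_brackets(1)[OF Wmod(1,2)] lam in auto)
    then show "comm (?d l) (?d m) v = (\<lambda>b. of_int (m - l) * ?d (m + l) v b
      + (if l = - m then of_int (l^3 - l) / 12 * ?z 1 v b else 0))"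
      by (simp only: if_distribR mult_zero_left if_distrib[of "\<lambda>c. c * _"] cong: if_cong)
    have "comm (?d l) (?I m) v = (\<lambda>b. of_int m * ?I (m + l) v b
      + (if l = - m then of_int (l^2 + l) else 0) * ?z 2 v b)"
    proof (rule comm_tens_op[OF fd fI fI fz'(2) _ _ v])
      show "comm (Vd l) (VI m) v = (\<lambda>b. of_int m * VI (m + l) v b
        + (if l = - m then of_int (l^2 + l) else 0) * Vz 2 v b)" if "v \<in> fsupp B0" for v
        using Vmod that unfolding L_module_def by (auto simp: fun_eq_iff)
    qed (use shift_brackets(2)[OF Wmod(1,2)] lam in auto)
    then show "comm (?d l) (?I m) v = (\<lambda>b. of_int m * ?I (m + l) v b
      + (if l = - m then of_int (l^2 + l) * ?z 2 v b else 0))"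
      by (simp only: mult_zero_left if_distrib[of "\<lambda>c. c * _"] cong: if_cong)
    have "comm (?I l) (?I m) v = (\<lambda>b. 0 * ?I m v b
      + (if l = - m then of_int l else 0) * ?z 3 v b)"
    proof (rule comm_tens_op[OF fI fI fI fz'(3) _ _ v])
      show "comm (VI l) (VI m) v = (\<lambda>b. 0 * VI m v b
        + (if l = - m then of_int l else 0) * Vz 3 v b)" if "v \<in> fsupp B0" for v
        using Vmod that unfolding L_module_def by (auto simp: fun_eq_iff)
    qed (use shift_brackets(3)[OF Wmod(1,2)] lam in auto)
    then show "comm (?I l) (?I m) v = (\<lambda>b. if l = - m then of_int l * ?z 3 v b else 0)"
      by (simp only: mult_zero_left if_distrib[of "\<lambda>c. c * _"] add_0_left cong: if_cong)
  next
    fix v k l assume v: "v \<in> fsupp Q" and k: "k \<in> {1, 2, 3::nat}"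
    have zero_shift: "shift_d (lam j) (Wd j) l (\<lambda>_. 0) = (\<lambda>_. 0)" "shift_I (lam j) (WI j) l (\<lambda>_. 0) = (\<lambda>_. 0)"
      if "j \<in> {1..n}" for j
      using fd[of l] fI[of l] that endo_zero unfolding factor_ops_def by blast+
    \<comment> \<open>Both scalars are 0; \<open>?z k\<close> only fills the operator positions of
      the bracket formula.\<close>
    have "comm (?z k) (?d l) v = (\<lambda>p. 0 * ?z k v p + 0 * ?z k v p)"
      by (rule comm_tens_op[OF fz[OF k] fd fz[OF k] fz[OF k] _ _ v])
         (use Vmod k zero_shift in \<open>auto simp: L_module_def comm_zero\<close>)
    then show "comm (?z k) (?d l) v = (\<lambda>_. 0)" by simp
    have "comm (?z k) (?I l) v = (\<lambda>p. 0 * ?z k v p + 0 * ?z k v p)"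
      by (rule comm_tens_op[OF fz[OF k] fI fz[OF k] fz[OF k] _ _ v])
         (use Vmod k zero_shift in \<open>auto simp: L_module_def comm_zero\<close>)
    then show "comm (?z k) (?I l) v = (\<lambda>_. 0)" by simp
    fix k' assume k': "k' \<in> {1, 2, 3::nat}"
    have "comm (?z k) (?z k') v = (\<lambda>p. 0 * ?z k v p + 0 * ?z k v p)"
      by (rule comm_tens_op[OF fz[OF k] fz[OF k'] fz[OF k] fz[OF k] _ _ v])
         (use Vmod k k' in \<open>auto simp: L_module_def comm_zero\<close>)
    then show "comm (?z k) (?z k') v = (\<lambda>_. 0)" by simp
  qed
  have "U = {\<lambda>_. 0} \<or> U = fsupp Q" if sub: "L_submodule Q ?d ?I ?z U" for U
  proof (cases "U = {\<lambda>_. 0}")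
    case False
    have U: "fun_vs.subspace U" "U \<subseteq> fsupp Q" "(\<lambda>_. 0) \<in> U"
      using sub unfolding L_submodule_def subspace_fun_iff by blast+
    have closed: "?d m u \<in> U" "?I m u \<in> U" if "u \<in> U" for u m
      using sub that unfolding L_submodule_def by blast+
    have closed_z: "?z k u \<in> U" if "u \<in> U" "k \<in> {1, 2, 3}" for u k
      using sub that unfolding L_submodule_def by blast
    have Vd: "\<And>m. endo_on (fsupp B0) (Vd m)" "\<And>m. endo_on (fsupp B0) (VI m)"
      using Vmod unfolding L_module_def by blast+
    \<comment> \<open>Here \<open>k\<close> is the exponent in \<open>t^k d/dt = d_(k-1)\<close>,
      matching the indexing of \<open>binom_coeff\<close>; the bound for the \<open>d\<close> part
      therefore becomes \<open>N + 1\<close>.\<close>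
    have V0: "\<exists>N::int. \<forall>k>N. Vd (k - 1) v = (\<lambda>_. 0)" "\<exists>N::int. \<forall>k>N. VI k v = (\<lambda>_. 0)"
      if v: "v \<in> fsupp B0" for v
    proof -
      obtain N where N: "\<forall>k>N. Vd k v = (\<lambda>_. 0) \<and> VI k v = (\<lambda>_. 0)"
        using V(2) v unfolding in_O_L_def by blast
      have "\<forall>k>N + 1. Vd (k - 1) v = (\<lambda>_. 0)" using N by simp
      then show "\<exists>N::int. \<forall>k>N. Vd (k - 1) v = (\<lambda>_. 0)" by (rule exI)
      have "\<forall>k>N. VI k v = (\<lambda>_. 0)" using N by simp
      then show "\<exists>N::int. \<forall>k>N. VI k v = (\<lambda>_. 0)" by (rule exI)
    qed
    have sd: "act0 (Vd m) u \<in> U" "\<And>j i. j \<in> {1..n} \<Longrightarrow> actj j (Wd j (int i - 1)) u \<in> U"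
      if u: "u \<in> U" for u m
    proof -
      have "tens_op (Vd (m - 1)) (\<lambda>j. series_op (binom_coeff (lam j) m) (\<lambda>i. Wd j (int i - 1))) n u \<in> U" for m
        using closed(1)[OF u, of "m - 1"] by (simp add: shift_d_series)
      note * = act_mem_of_tens_op_mem[OF U(1) subsetD[OF U(2) u] Vd(1) V0(1) LF(1) _ lam(2) this]
      show "act0 (Vd m) u \<in> U" using *(2)[of "m + 1"] lam(1) by simp
      show "actj j (Wd j (int i - 1)) u \<in> U" if "j \<in> {1..n}" for j i
        using *(1) lam(1) that by simp
    qed
    have sI: "act0 (VI m) u \<in> U" "\<And>j i. j \<in> {1..n} \<Longrightarrow> actj j (WI j (int i)) u \<in> U"
      if u: "u \<in> U" for u m
    proof -
      have "tens_op (VI m) (\<lambda>j. series_op (binom_coeff (lam j) m) (\<lambda>i. WI j (int i))) n u \<in> U" for m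
        using closed(2)[OF u, of m] by (simp add: shift_I_series)
      note * = act_mem_of_tens_op_mem[OF U(1) subsetD[OF U(2) u] Vd(2) V0(2) LF(2) _ lam(2) this]
      show "act0 (VI m) u \<in> U" using *(2)[of m] lam(1) by simp
      show "actj j (WI j (int i)) u \<in> U" if "j \<in> {1..n}" for j i
        using *(1) lam(1) that by simp
    qed
    \<comment> \<open>The centre acts by zero on every \<open>W_j\<close>, so nothing has to be
      separated.\<close>
    have sz: "act0 (Vz k) u \<in> U" if u: "u \<in> U" and k: "k \<in> {1, 2, 3}" for u k
      using closed_z[OF u k] tens_op_act[OF fz[OF k] subsetD[OF U(2) u]] by (simp add: act_def)
    have units: "actj j (\<lambda>w x. w c * delta b x) u \<in> U"
      if j: "j \<in> {1..n}" and b: "b \<in> Bs j" and u: "u \<in> U" for j b c u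
      using sd(2)[OF _ j] sI(2)[OF _ j]
      by (intro slot.matrix_unit_closed[OF slotj[OF j] simple_W_operator_module[OF Wmod(3)[OF j]] U(1,2) _ b u])
         auto
    obtain u where u: "u \<in> U" "u \<noteq> (\<lambda>_. 0)" using False U(3) by blast
    \<comment> \<open>This fixes a basis tensor \<open>g\<close> of the \<open>W_j\<close> along
      which \<open>u\<close> has a nonzero component in \<open>V\<close>.\<close>
    then obtain a0 g where ag: "u (a0, g) \<noteq> 0" by fastforce
    have uQ: "u \<in> fsupp Q" using u U by blast
    have "(a0, g) \<in> Q"
    proof (rule ccontr)
      assume "(a0, g) \<notin> Q"
      with fsupp_outside[OF uQ this] ag show False by simp
    qed
    then have g: "g \<in> PiE {1..n} Bs" by (simp add: Q_def)
    have all: "(\<lambda>(a, q). if q = h then v a else 0) \<in> U"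
      if h: "h \<in> PiE {1..n} Bs" and v: "v \<in> fsupp B0" for h v
    proof -
      \<comment> \<open>\<open>?t v\<close> is the pure tensor of \<open>v\<close> with the basis
        element \<open>h\<close>. The \<open>v\<close> for which it lies in \<open>U\<close> form a
        submodule of \<open>V\<close> that contains the nonzero component of \<open>u\<close> along
        \<open>g\<close>.\<close>
      let ?t = "\<lambda>v (a, q). if q = h then v a else (0::complex)"
      let ?V = "{v \<in> fsupp B0. ?t v \<in> U}"
      have act_t: "act0 A (?t v) = ?t (A v)" if "endo_on (fsupp B0) A" for A v
      proof
        fix p :: "'a \<times> (nat \<Rightarrow> 'b)"
        show "act0 A (?t v) p = ?t (A v) p"
          using endo_zero[OF that] by (cases "snd p = h") (simp_all add: act_def case_prod_unfold)
      qed
      have "L_submodule B0 Vd VI Vz ?V"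
        unfolding L_submodule_def
      proof (intro conjI ballI allI)
        show "?V \<subseteq> fsupp B0" by blast
        show "(\<lambda>_. 0) \<in> ?V" using U(3) fsupp_zero by (simp add: case_prod_unfold)
        fix f assume f: "f \<in> ?V"
        have "(\<lambda>p. c * ?t f p) \<in> U" for c using U(1) f unfolding subspace_fun_iff by blast
        moreover have "(\<lambda>p. c * ?t f p) = ?t (\<lambda>b. c * f b)" for c by auto
        ultimately show "(\<lambda>b. c * f b) \<in> ?V" for c using f fsupp_scale by auto
        show "Vd m f \<in> ?V" for m
          using sd(1)[of "?t f" m] act_t[OF Vd(1)] endo_closed[OF Vd(1)] f by auto
        show "VI m f \<in> ?V" for m
          using sI(1)[of "?t f" m] act_t[OF Vd(2)] endo_closed[OF Vd(2)] f by auto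
        show "Vz k f \<in> ?V" if k: "k \<in> {1, 2, 3}" for k
        proof -
          have E: "endo_on (fsupp B0) (Vz k)" using Vmod k unfolding L_module_def by blast
          show ?thesis using sz[OF _ k, of "?t f"] act_t[OF E] endo_closed[OF E] f by auto
        qed
        fix f' assume f': "f' \<in> ?V"
        have "(\<lambda>p. ?t f p + ?t f' p) \<in> U" using U(1) f f' unfolding subspace_fun_iff by blast
        moreover have "(\<lambda>p. ?t f p + ?t f' p) = ?t (\<lambda>b. f b + f' b)" by auto
        ultimately show "(\<lambda>b. f b + f' b) \<in> ?V" using f f' fsupp_add by auto
      qed
      moreover have "(\<lambda>a. u (a, g)) \<in> ?V"
        using pure_tensor_mem[OF units u(1) uQ g h] slot.slice_fsupp[OF slot0 uQ, of "(a0, g)"] by simp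
      moreover have "(\<lambda>a. u (a, g)) \<noteq> (\<lambda>_. 0)" using ag by metis
      ultimately have "?V = fsupp B0" using V(1) unfolding simple_L_def by blast
      then show ?thesis using v by blast
    qed
    have deltas: "delta p \<in> U" if p: "p \<in> Q" for p
    proof -
      obtain a h where ah: "p = (a, h)" "a \<in> B0" "h \<in> PiE {1..n} Bs" using p by (auto simp: Q_def)
      have "(\<lambda>(a', q). if q = h then delta a a' else 0) = delta p"
        by (auto simp: fun_eq_iff delta_def ah)
      then show ?thesis using all[OF ah(3) fsupp_delta[OF ah(2)]] by simp
    qed
    have "f \<in> U" if f: "f \<in> fsupp Q" for f
    proof -
      have id: "endo_on (fsupp Q) (\<lambda>f. f)" by (simp add: endo_on_def)
      have "f = (\<lambda>b. \<Sum>c\<in>{c. f c \<noteq> 0}. f c * delta c b)"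
        using endo_kernel[OF id f fsupp_finite[OF f] subset_refl] by blast
      moreover have "(\<lambda>b. \<Sum>c\<in>{c. f c \<noteq> 0}. f c * delta c b) \<in> U"
        using fsupp_outside[OF f] by (intro subspace_fun_sum[OF U(1)] deltas) auto
      ultimately show ?thesis by simp
    qed
    then show ?thesis using U(2) by blast
  qed simp
  moreover have "Q \<noteq> {}"
  proof -
    have "B0 \<noteq> {}" using V(1) unfolding simple_L_def by blast
    moreover have "PiE {1..n} Bs \<noteq> {}" using Wmod(3) unfolding simple_W_def by (auto simp: PiE_eq_empty_iff)
    ultimately show ?thesis by (simp add: Q_def)
  qed
  ultimately show ?thesis using module unfolding simple_L_def Q_def by blast
qed

end
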